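(* Let $n\ge 2$. For $i=1,\dots,n-1$ let $$D_i=\langle \varepsilon_{i+1,1},\varepsilon_{i+1,2},\ldots,\varepsilon_{i+1,i},\ \varepsilon_{1,i+1},\varepsilon_{2,i+1},\ldots,\varepsilon_{i,i+1}\rangle\le Cb_n .$$ Then the group of basis-conjugating automorphisms $Cb_n$ is a semidirect product $$Cb_n=D_{n-1}\rtimes\bigl(D_{n-2}\rtimes(\cdots\rtimes(D_2\rtimes D_1))\cdots\bigr).$$ For each $i=1,\dots,n-1$, the elements $\varepsilon_{i+1,1},\varepsilon_{i+1,2},\ldots,\varepsilon_{i+1,i}$ generate a free group of rank $i$, and the elements $\varepsilon_{1,i+1},\varepsilon_{2,i+1},\ldots,\varepsilon_{i,i+1}$ generate a free abelian group of rank $i$. Moreover this decomposition is consistent with the decomposition $P_n=U_n\rtimes(U_{n-1}\rtimes(\cdots\rtimes(U_3\rtimes U_2))\cdots)$ of the pure braid group, i.e. $U_{i+1}\le D_i$ for $i=1,2,\ldots,n-1$.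
   Context: $F_n$ is the free group with free generators $x_1,\dots,x_n$. Products of automorphisms are read from left to right: $\alpha\beta$ means first apply $\alpha$, then $\beta$. For $1\le i\ne j\le n$, $\varepsilon_{ij}\in\mathrm{Aut}(F_n)$ is given by $x_i\mapsto x_j^{-1}x_ix_j$ and $x_l\mapsto x_l$ for $l\ne i$. $Cb_n$ is the group of basis-conjugating automorphisms: the automorphisms sending each $x_i$ to $f_i^{-1}x_if_i$ for some $f_i\in F_n$; it is generated by all $\varepsilon_{ij}$, $1\le i\ne j\le n$. Semidirect product convention: a group $G$ is a semidirect product $A\rtimes B$ of subgroups $A,B$ if $G=AB$, $A$ is normal in $G$, and $A\cap B=1$. The iterated product above is the internal one: each bracket $D_i\rtimes(D_{i-1}\rtimes\cdots)$ is the subgroup generated by $D_1,\dots,D_i$. $[a,b]=a^{-1}b^{-1}ab$. The pure braid group $P_n$ is regarded as the subgroup of $Cb_n$ generated by the automorphisms $a_{rs}$, $1\le r<s\le n$, where $a_{rs}$ acts by: $x_i\mapsto x_i$ if $s<i$ or $i<r$; $x_r\mapsto x_rx_sx_rx_s^{-1}x_r^{-1}$; $x_i\mapsto [x_r^{-1},x_s^{-1}]\,x_i\,[x_r^{-1},x_s^{-1}]^{-1}$ if $r<i<s$; $x_s\mapsto x_rx_sx_r^{-1}$. For $i=2,\dots,n$, $U_i=\langle a_{1,i},a_{2,i},\ldots,a_{i-1,i}\rangle$ (a free group of rank $i-1$). *)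

theory Defs
  imports "HOL-Algebra.Free_Abelian_Groups" "HOL-Algebra.Bij"
begin

section \<open>Free groups\<close>

text \<open>
  A letter \<open>(a, True)\<close> stands for the generator \<open>a\<close>, and \<open>(a, False)\<close> for its formal inverse.
  The elements of the free group are the reduced words; the product is concatenation followed by
  free reduction, where \<^term>\<open>u\<close> is pushed onto the reduced word \<^term>\<open>v\<close> letter by letter.
\<close>

type_synonym 'a word = "('a \<times> bool) list"

definition cancels :: "'a \<times> bool \<Rightarrow> 'a \<times> bool \<Rightarrow> bool" where
  "cancels l m \<longleftrightarrow> fst l = fst m \<and> snd l \<noteq> snd m"

definition reduced :: "'a word \<Rightarrow> bool" where
  "reduced w \<longleftrightarrow> successively (\<lambda>l m. \<not> cancels l m) w"

fun push :: "'a \<times> bool \<Rightarrow> 'a word \<Rightarrow> 'a word" where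
  "push l [] = [l]"
| "push l (m # w) = (if cancels l m then w else l # m # w)"

definition free_group :: "'a set \<Rightarrow> 'a word monoid" where
  "free_group X =
     \<lparr>carrier = {w. reduced w \<and> set w \<subseteq> X \<times> UNIV}, monoid.mult = (\<lambda>u v. foldr push u v), one = []\<rparr>"

definition free_gen :: "'a \<Rightarrow> 'a word" where
  "free_gen a = [(a, True)]"

text \<open>The extension of a map on the generators to a homomorphism into \<open>G\<close>.\<close>

definition free_lift :: "('b, 'c) monoid_scheme \<Rightarrow> ('a \<Rightarrow> 'b) \<Rightarrow> 'a word \<Rightarrow> 'b" where
  "free_lift G f w =
     foldr (\<lambda>(a, b) y. (if b then f a else inv\<^bsub>G\<^esub> (f a)) \<otimes>\<^bsub>G\<^esub> y) w \<one>\<^bsub>G\<^esub>"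

lemma reduced_push: "reduced w \<Longrightarrow> reduced (push l w)"
  by (cases w) (auto simp: reduced_def successively_Cons)

lemma set_push: "set (push l w) \<subseteq> insert l (set w)"
  by (cases w) auto

lemma reduced_foldr_push: "reduced v \<Longrightarrow> reduced (foldr push u v)"
  by (induction u) (auto intro: reduced_push)

lemma set_foldr_push: "set (foldr push u v) \<subseteq> set u \<union> set v"
  by (induction u) (use set_push in fastforce)+

lemma push_reduced: "reduced (l # w) \<Longrightarrow> push l w = l # w"
  by (cases w) (auto simp: reduced_def)

lemma push_push_cancel:
  assumes "reduced w" "cancels l m"
  shows "push l (push m w) = w"
proof (cases w)
  case (Cons k w')
  show ?thesis
  proof (cases "cancels m k")
    case True
    then have "k = l"
      using assms(2) by (auto simp: cancels_def prod_eq_iff)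
    then show ?thesis
      using True Cons assms(1) push_reduced[of l w'] by simp
  qed (use Cons assms(2) in simp)
qed (use assms(2) in simp)

lemma foldr_push_push:
  assumes "reduced u" "reduced v"
  shows "foldr push (push l u) v = push l (foldr push u v)"
proof (cases u)
  case (Cons m u')
  then show ?thesis
    using push_push_cancel[OF reduced_foldr_push[OF assms(2)], of l m u'] by auto
qed auto

lemma foldr_push_assoc:
  assumes "reduced v" "reduced w"
  shows "foldr push (foldr push u v) w = foldr push u (foldr push v w)"
  by (induction u) (simp_all add: foldr_push_push reduced_foldr_push assms)

lemma foldr_push_Nil: "reduced w \<Longrightarrow> foldr push w [] = w"
proof (induction w)
  case (Cons l w)
  then have "reduced w"
    by (cases w) (auto simp: reduced_def)
  then show ?case
    using Cons push_reduced[of l w] by simp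
qed simp

definition word_inv :: "'a word \<Rightarrow> 'a word" where
  "word_inv w = rev (map (\<lambda>(a, b). (a, \<not> b)) w)"

lemma foldr_push_word_inv: "reduced v \<Longrightarrow> foldr push (word_inv w) (foldr push w v) = v"
proof (induction w)
  case (Cons l w)
  have "push (fst l, \<not> snd l) (push l (foldr push w v)) = foldr push w v"
    by (rule push_push_cancel) (auto simp: reduced_foldr_push Cons.prems cancels_def)
  then show ?case
    using Cons by (simp add: word_inv_def case_prod_beta)
qed (simp add: word_inv_def)

lemma reduced_word_inv: "reduced w \<Longrightarrow> reduced (word_inv w)"
  unfolding reduced_def word_inv_def successively_rev successively_map
  by (erule successively_mono) (auto simp: cancels_def)

lemma group_free_group: "group (free_group X)"
proof (rule groupI)
  fix u v assume "u \<in> carrier (free_group X)" "v \<in> carrier (free_group X)"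
  then show "u \<otimes>\<^bsub>free_group X\<^esub> v \<in> carrier (free_group X)"
    using set_foldr_push[of u v] by (auto simp: free_group_def reduced_foldr_push)
next
  fix w assume w: "w \<in> carrier (free_group X)"
  then have "set (word_inv w) \<subseteq> X \<times> UNIV"
    by (auto simp: free_group_def word_inv_def)
  moreover have "foldr push (word_inv w) w = []"
    using foldr_push_word_inv[of "[]" w] foldr_push_Nil[of w] w
    by (simp add: free_group_def reduced_def)
  ultimately show "\<exists>v\<in>carrier (free_group X). v \<otimes>\<^bsub>free_group X\<^esub> w = \<one>\<^bsub>free_group X\<^esub>"
    using w by (intro bexI[of _ "word_inv w"]) (auto simp: free_group_def reduced_word_inv)
qed (auto simp: free_group_def foldr_push_assoc reduced_def[of "[]"])

lemma (in group) free_lift_closed: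
  assumes "f \<in> X \<rightarrow> carrier G" "set w \<subseteq> X \<times> UNIV"
  shows "free_lift G f w \<in> carrier G"
  using assms(2)
proof (induction w)
  case (Cons l w)
  moreover have "f (fst l) \<in> carrier G"
    using Cons.prems assms(1) by auto
  ultimately show ?case
    by (auto simp: free_lift_def case_prod_beta)
qed (simp add: free_lift_def)

lemma (in group) free_lift_push:
  assumes f: "f \<in> X \<rightarrow> carrier G" and l: "fst l \<in> X" and w: "set w \<subseteq> X \<times> UNIV"
  shows "free_lift G f (push l w) = free_lift G f (l # w)"
proof (cases w)
  case (Cons m w')
  have c: "f (fst l) \<in> carrier G" "free_lift G f w' \<in> carrier G"
    using f l w Cons free_lift_closed[OF f, of w'] by auto
  show ?thesis
  proof (cases "cancels l m")
    case True
    then have m: "fst m = fst l" "snd m = (\<not> snd l)"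
      by (auto simp: cancels_def)
    have "free_lift G f (l # w) = free_lift G f w'"
      using c m by (cases "snd l")
        (auto simp: Cons free_lift_def case_prod_beta m_assoc[symmetric])
    then show ?thesis using True Cons by simp
  qed (simp add: Cons)
qed simp

lemma (in group) free_lift_hom:
  assumes f: "f \<in> X \<rightarrow> carrier G"
  shows "free_lift G f \<in> hom (free_group X) G"
proof (rule homI)
  fix u v assume u: "u \<in> carrier (free_group X)" and v: "v \<in> carrier (free_group X)"
  have "set u \<subseteq> X \<times> UNIV"
    using u by (simp add: free_group_def)
  then have "free_lift G f (foldr push u v) = free_lift G f u \<otimes> free_lift G f v"
  proof (induction u)
    case Nil
    then show ?case
      using v free_lift_closed[OF f, of v] by (simp add: free_lift_def free_group_def)
  next
    case (Cons l u)
    have "set (foldr push u v) \<subseteq> X \<times> UNIV"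
      using set_foldr_push[of u v] Cons.prems v by (auto simp: free_group_def)
    then have "free_lift G f (foldr push (l # u) v) = free_lift G f (l # foldr push u v)"
      using free_lift_push[OF f, of l] Cons.prems by auto
    also have "\<dots> = free_lift G f (l # u) \<otimes> free_lift G f v"
      using Cons f v free_lift_closed[OF f, of u] free_lift_closed[OF f, of v]
      by (auto simp: free_lift_def case_prod_beta m_assoc free_group_def mem_Times_iff Pi_iff)
    finally show ?case .
  qed
  then show "free_lift G f (u \<otimes>\<^bsub>free_group X\<^esub> v) = free_lift G f u \<otimes> free_lift G f v"
    by (simp add: free_group_def)
qed (use free_lift_closed[OF f] in \<open>auto simp: free_group_def\<close>)

lemma (in group) free_lift_gen: "f a \<in> carrier G \<Longrightarrow> free_lift G f (free_gen a) = f a"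
  by (simp add: free_lift_def free_gen_def)


section \<open>Free and free abelian bases of subgroups, semidirect products\<close>

definition freely_generates :: "('b, 'c) monoid_scheme \<Rightarrow> 'a set \<Rightarrow> ('a \<Rightarrow> 'b) \<Rightarrow> bool" where
  "freely_generates G I f \<longleftrightarrow>
     (\<exists>h \<in> iso (free_group I) (G\<lparr>carrier := generate G (f ` I)\<rparr>). \<forall>a\<in>I. h (free_gen a) = f a)"

definition freely_abelian_generates :: "('b, 'c) monoid_scheme \<Rightarrow> 'a set \<Rightarrow> ('a \<Rightarrow> 'b) \<Rightarrow> bool" where
  "freely_abelian_generates G I f \<longleftrightarrow>
     (\<exists>h \<in> iso (free_Abelian_group I) (G\<lparr>carrier := generate G (f ` I)\<rparr>).
        \<forall>a\<in>I. h (frag_of a) = f a)"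

definition is_semidirect :: "('a, 'b) monoid_scheme \<Rightarrow> 'a set \<Rightarrow> 'a set \<Rightarrow> bool" where
  "is_semidirect G A B \<longleftrightarrow>
     A \<lhd> G \<and> subgroup B G \<and> A <#>\<^bsub>G\<^esub> B = carrier G \<and> A \<inter> B = {\<one>\<^bsub>G\<^esub>}"

definition generated_upto :: "('a, 'b) monoid_scheme \<Rightarrow> (nat \<Rightarrow> 'a set) \<Rightarrow> nat \<Rightarrow> 'a set" where
  "generated_upto G D i = generate G (\<Union>k\<in>{1..i}. D k)"

text \<open>\<open>G = D m \<rtimes> (D (m - 1) \<rtimes> (\<dots> \<rtimes> (D 2 \<rtimes> D 1)\<dots>))\<close>, as an internal iterated product:\<close>

definition is_iterated_semidirect :: "('a, 'b) monoid_scheme \<Rightarrow> (nat \<Rightarrow> 'a set) \<Rightarrow> nat \<Rightarrow> bool" where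
  "is_iterated_semidirect G D m \<longleftrightarrow>
     group G \<and> (\<forall>i\<in>{1..m}. subgroup (D i) G) \<and> generated_upto G D m = carrier G \<and>
     (\<forall>i\<in>{2..m}. is_semidirect (G\<lparr>carrier := generated_upto G D i\<rparr>)
                    (D i) (generated_upto G D (i - 1)))"


section \<open>Basis-conjugating automorphisms\<close>

abbreviation Fn :: "nat \<Rightarrow> nat word monoid" where
  "Fn n \<equiv> free_group {1..n}"

abbreviation xg :: "nat \<Rightarrow> nat word" where
  "xg i \<equiv> free_gen i"

text \<open>
  Products of automorphisms are read from left to right, opposite to \<^const>\<open>AutoGroup\<close>.
\<close>

definition Aut :: "('a, 'b) monoid_scheme \<Rightarrow> ('a \<Rightarrow> 'a) monoid" where
  "Aut G = (AutoGroup G)\<lparr>monoid.mult := (\<lambda>\<alpha> \<beta>. \<beta> \<otimes>\<^bsub>AutoGroup G\<^esub> \<alpha>)\<rparr>"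

definition Cb :: "nat \<Rightarrow> (nat word \<Rightarrow> nat word) monoid" where
  "Cb n = (Aut (Fn n))\<lparr>carrier :=
     {\<phi> \<in> carrier (Aut (Fn n)).
        \<forall>i\<in>{1..n}. \<exists>f\<in>carrier (Fn n). \<phi> (xg i) = inv\<^bsub>Fn n\<^esub> f \<otimes>\<^bsub>Fn n\<^esub> xg i \<otimes>\<^bsub>Fn n\<^esub> f}\<rparr>"

text \<open>
  The endomorphism of \<open>Fn n\<close> with prescribed images of the generators. It is restricted to the
  carrier because elements of \<^const>\<open>AutoGroup\<close> are extensional.
\<close>

definition endo :: "nat \<Rightarrow> (nat \<Rightarrow> nat word) \<Rightarrow> nat word \<Rightarrow> nat word" where
  "endo n g = restrict (free_lift (Fn n) g) (carrier (Fn n))"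

definition eps :: "nat \<Rightarrow> nat \<Rightarrow> nat \<Rightarrow> nat word \<Rightarrow> nat word" where
  "eps n i j = endo n (\<lambda>l. if l = i then inv\<^bsub>Fn n\<^esub> xg j \<otimes>\<^bsub>Fn n\<^esub> xg i \<otimes>\<^bsub>Fn n\<^esub> xg j else xg l)"

definition Dsub :: "nat \<Rightarrow> nat \<Rightarrow> (nat word \<Rightarrow> nat word) set" where
  "Dsub n i = generate (Cb n) ((\<lambda>j. eps n (i + 1) j) ` {1..i} \<union> (\<lambda>j. eps n j (i + 1)) ` {1..i})"


section \<open>Pure braids\<close>

definition commutator :: "('a, 'b) monoid_scheme \<Rightarrow> 'a \<Rightarrow> 'a \<Rightarrow> 'a" where
  "commutator G a b = inv\<^bsub>G\<^esub> a \<otimes>\<^bsub>G\<^esub> inv\<^bsub>G\<^esub> b \<otimes>\<^bsub>G\<^esub> a \<otimes>\<^bsub>G\<^esub> b"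

definition braid_a :: "nat \<Rightarrow> nat \<Rightarrow> nat \<Rightarrow> nat word \<Rightarrow> nat word" where
  "braid_a n r s = endo n (\<lambda>i.
     if s < i \<or> i < r then xg i
     else if i = r then
       xg r \<otimes>\<^bsub>Fn n\<^esub> xg s \<otimes>\<^bsub>Fn n\<^esub> xg r \<otimes>\<^bsub>Fn n\<^esub> inv\<^bsub>Fn n\<^esub> xg s \<otimes>\<^bsub>Fn n\<^esub> inv\<^bsub>Fn n\<^esub> xg r
     else if i = s then xg r \<otimes>\<^bsub>Fn n\<^esub> xg s \<otimes>\<^bsub>Fn n\<^esub> inv\<^bsub>Fn n\<^esub> xg r
     else
       (let c = commutator (Fn n) (inv\<^bsub>Fn n\<^esub> xg r) (inv\<^bsub>Fn n\<^esub> xg s)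
        in c \<otimes>\<^bsub>Fn n\<^esub> xg i \<otimes>\<^bsub>Fn n\<^esub> inv\<^bsub>Fn n\<^esub> c))"

definition Usub :: "nat \<Rightarrow> nat \<Rightarrow> (nat word \<Rightarrow> nat word) set" where
  "Usub n i = generate (Cb n) ((\<lambda>r. braid_a n r i) ` {1..<i})"

end

theory Submission
  imports Defs
begin

text \<open>
  Throughout, \<open>\<epsilon>\<^sub>i\<^sub>j\<close> is \<open>eps n i j\<close>, the automorphism that conjugates \<open>x\<^sub>i\<close> by \<open>x\<^sub>j\<close>.

  That the \<open>\<epsilon>\<^sub>i\<^sub>j\<close> generate all basis-conjugating automorphisms is a length argument
  (\<open>conjugators_imp_generate\<close>). Let \<open>\<phi> x\<^sub>i = f\<^sub>i\<inverse> x\<^sub>i f\<^sub>i\<close>. If some \<open>f\<^sub>i\<close> ends with \<open>x\<^sub>j\<^sup>\<plusminus>\<^sup>1 f\<^sub>j\<close> for a \<open>j \<noteq> i\<close>,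
  then multiplying \<open>\<phi>\<close> by \<open>\<epsilon>\<^sub>i\<^sub>j\<^sup>\<plusminus>\<^sup>1\<close> shortens \<open>f\<^sub>i\<close>. If this never happens and no \<open>f\<^sub>i\<close> starts with
  \<open>x\<^sub>i\<^sup>\<plusminus>\<^sup>1\<close>, then in the image of a reduced word the middle letters of the conjugates never cancel
  (\<open>Cb_image_prefix\<close>). As \<open>\<phi>\<close> is surjective, the single letters \<open>x\<^sub>k\<close> are such images, and that
  leaves only \<open>f\<^sub>k = 1\<close>.

  Normality of \<open>D\<^sub>i\<close> in the subgroup generated by \<open>D\<^sub>1, \<dots>, D\<^sub>i\<close> follows from McCool's relations
  (\<open>eps_commute_same\<close>, \<open>eps_commute_disjoint\<close>, \<open>eps_McCool\<close>): conjugation of a generator of \<open>D\<^sub>i\<close> by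
  \<open>\<epsilon>\<^sub>j\<^sub>k\<close> with \<open>j, k \<le> i\<close> can be replaced by conjugation inside \<open>D\<^sub>i\<close> (\<open>eps_conj_Dsub_gens\<close>). The two factors
  meet trivially because killing \<open>x\<^bsub>i+1\<^esub>\<close> makes \<open>D\<^sub>i\<close> act trivially, whereas the other factor commutes
  with killing \<open>x\<^bsub>i+1\<^esub>\<close> and fixes it (\<open>Dsub_semidirect\<close>).

  Freeness is read off from the images of the generators. A product of the \<open>\<epsilon>\<^sub>m\<^sub>j\<close> conjugates \<open>x\<^sub>m\<close> by the
  corresponding word, read backwards (\<open>eps_free\<close>), and a product of powers of the \<open>\<epsilon>\<^sub>j\<^sub>m\<close> conjugates
  each \<open>x\<^sub>j\<close> by the corresponding power of \<open>x\<^sub>m\<close> (\<open>eps_free_abelian\<close>). Finally, the braid generators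
  with larger index \<open>i + 1\<close> are explicit products of generators of \<open>D\<^sub>i\<close> and their inverses
  (\<open>braid_a_in_Dsub\<close>).
\<close>


section \<open>Conjugation and semidirect products\<close>

text \<open>
  Simplification would otherwise turn the index sets \<open>{1..n}\<close> into \<open>{Suc 0..n}\<close>, so that facts about
  \<open>Fn n\<close> no longer match.
\<close>

declare One_nat_def [simp del]

lemma (in group) inv_cancel_left:
  assumes "x \<in> carrier G" "y \<in> carrier G"
  shows "x \<otimes> (inv x \<otimes> y) = y" "inv x \<otimes> (x \<otimes> y) = y"
  using assms by (simp_all flip: m_assoc)

lemma (in group) int_pow_conj_self:
  assumes "x \<in> carrier G"
  shows "inv (x [^] (k::int)) \<otimes> x \<otimes> x [^] k = x"
proof -
  have "x \<otimes> x [^] k = x [^] k \<otimes> x"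
    using int_pow_mult[OF assms, of 1 k] int_pow_mult[OF assms, of k 1] assms
    by (simp add: add.commute)
  then show ?thesis
    using assms by (simp add: m_assoc inv_cancel_left)
qed

lemma (in group) commute_imp_conj_eq:
  assumes "x \<otimes> y = y \<otimes> x" "x \<in> carrier G" "y \<in> carrier G"
  shows "x \<otimes> y \<otimes> inv x = y" "inv x \<otimes> y \<otimes> x = y"
proof -
  show "x \<otimes> y \<otimes> inv x = y"
    using assms by (simp add: m_assoc)
  have "inv x \<otimes> y \<otimes> x = inv x \<otimes> (x \<otimes> y)"
    using assms by (simp add: m_assoc)
  then show "inv x \<otimes> y \<otimes> x = y"
    using assms(2,3) by (simp add: inv_cancel_left)
qed

text \<open>
  The product \<open>a b\<close> centralises \<open>c\<close>, so \<open>a\<close> acts on \<open>c\<close> as \<open>b\<inverse>\<close> does. This trades conjugation by an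
  element outside a subgroup for conjugation by an element inside it.
\<close>

lemma (in group) conj_eq_conj_by_partner:
  assumes "a \<otimes> b = b \<otimes> a" "a \<otimes> b \<otimes> c = c \<otimes> (a \<otimes> b)" "a \<in> carrier G" "b \<in> carrier G" "c \<in> carrier G"
  shows "a \<otimes> c \<otimes> inv a = inv b \<otimes> c \<otimes> b" "inv a \<otimes> c \<otimes> a = b \<otimes> c \<otimes> inv b"
proof -
  have "b \<otimes> (a \<otimes> c \<otimes> inv a) \<otimes> inv b = (a \<otimes> b) \<otimes> c \<otimes> inv (a \<otimes> b)"
    using assms(3-) by (simp add: assms(1) m_assoc inv_mult_group)
  then have *: "b \<otimes> (a \<otimes> c \<otimes> inv a) \<otimes> inv b = c"
    using commute_imp_conj_eq(1)[OF assms(2)] assms(3-) by simp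
  have "inv b \<otimes> (b \<otimes> (a \<otimes> c \<otimes> inv a) \<otimes> inv b) \<otimes> b = a \<otimes> c \<otimes> inv a"
    using assms(3-) by (simp add: m_assoc inv_cancel_left)
  then show "a \<otimes> c \<otimes> inv a = inv b \<otimes> c \<otimes> b"
    using * by simp
  have "inv b \<otimes> (inv a \<otimes> c \<otimes> a) \<otimes> b = inv (a \<otimes> b) \<otimes> c \<otimes> (a \<otimes> b)"
    using assms(3-) by (simp add: m_assoc inv_mult_group)
  then have *: "inv b \<otimes> (inv a \<otimes> c \<otimes> a) \<otimes> b = c"
    using commute_imp_conj_eq(2)[OF assms(2)] assms(3-) by simp
  have "b \<otimes> (inv b \<otimes> (inv a \<otimes> c \<otimes> a) \<otimes> b) \<otimes> inv b = inv a \<otimes> c \<otimes> a"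
    using assms(3-) by (simp add: m_assoc inv_cancel_left)
  then show "inv a \<otimes> c \<otimes> a = b \<otimes> c \<otimes> inv b"
    using * by simp
qed

lemma (in group) conj_generate:
  assumes T: "T \<subseteq> carrier G" and g: "g \<in> carrier G"
    and conj: "\<And>t. t \<in> T \<Longrightarrow> g \<otimes> t \<otimes> inv g \<in> generate G T" and x: "x \<in> generate G T"
  shows "g \<otimes> x \<otimes> inv g \<in> generate G T"
  using x
proof induction
  case one
  show ?case using g by (simp add: generate.one)
next
  case (incl h)
  then show ?case by (rule conj)
next
  case (inv h)
  then have "inv (g \<otimes> h \<otimes> inv g) = g \<otimes> inv h \<otimes> inv g"
    using T g by (auto simp: inv_mult_group m_assoc)
  then show ?case
    using generate_m_inv_closed[OF T conj[OF inv]] by simp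
next
  case (eng x y)
  then have "x \<in> carrier G" "y \<in> carrier G"
    using generate_incl[OF T] by auto
  then have "g \<otimes> (x \<otimes> y) \<otimes> inv g = (g \<otimes> x \<otimes> inv g) \<otimes> (g \<otimes> y \<otimes> inv g)"
    using g by (simp add: m_assoc inv_cancel_left)
  then show ?case
    using generate.eng[OF eng.IH] by simp
qed

text \<open>
  Normality can be tested on generators, but both \<open>s\<close> and \<open>s\<inverse>\<close> have to be tested: in an infinite group
  \<open>s A s\<inverse> \<subseteq> A\<close> does not imply equality. Normality then lets every product of generators be
  collected into the form \<open>a b\<close>.
\<close>

lemma (in group) is_semidirect_generateI:
  assumes S: "S \<subseteq> carrier G" and T: "T \<subseteq> carrier G"
    and conj: "\<And>s t. s \<in> S \<Longrightarrow> t \<in> T \<Longrightarrow> s \<otimes> t \<otimes> inv s \<in> generate G T"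
    and conj_inv: "\<And>s t. s \<in> S \<Longrightarrow> t \<in> T \<Longrightarrow> inv s \<otimes> t \<otimes> s \<in> generate G T"
    and int: "\<And>x. x \<in> generate G T \<Longrightarrow> x \<in> generate G S \<Longrightarrow> x = \<one>"
  shows "is_semidirect (G\<lparr>carrier := generate G (S \<union> T)\<rparr>) (generate G T) (generate G S)"
proof -
  let ?A = "generate G T" and ?B = "generate G S" and ?C = "generate G (S \<union> T)"
  have A: "subgroup ?A G" and B: "subgroup ?B G" and C: "subgroup ?C G"
    using S T by (simp_all add: generate_is_subgroup)
  have AC: "?A \<subseteq> ?C" and BC: "?B \<subseteq> ?C"
    by (simp_all add: mono_generate)
  interpret C: group "G\<lparr>carrier := ?C\<rparr>"
    by (rule subgroup_imp_group[OF C])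
  have N: "g \<otimes> x \<otimes> inv g \<in> ?A" if "g \<in> ?C" "x \<in> ?A" for g x
    using that
  proof (induction g arbitrary: x)
    case one
    then show ?case using subgroup.mem_carrier[OF A] by simp
  next
    case (incl h)
    then show ?case
    proof (elim UnE)
      show ?thesis if "h \<in> S"
        using conj_generate[OF T _ conj incl.prems] that S by blast
      show ?thesis if "h \<in> T"
        using generate.incl[OF that, of G] incl.prems
        by (simp add: subgroup.m_closed[OF A] subgroup.m_inv_closed[OF A])
    qed
  next
    case (inv h)
    have h: "h \<in> carrier G" using inv S T by auto
    from inv.hyps show ?case
    proof (elim UnE)
      assume "h \<in> S"
      then have "\<And>t. t \<in> T \<Longrightarrow> inv h \<otimes> t \<otimes> inv (inv h) \<in> ?A"
        using conj_inv h by simp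
      then show ?thesis
        using conj_generate[OF T _ _ inv.prems, of "inv h"] h by simp
    next
      show ?thesis if "h \<in> T"
        using generate.incl[OF that, of G] inv.prems
        by (simp add: subgroup.m_closed[OF A] subgroup.m_inv_closed[OF A])
    qed
  next
    case (eng g h)
    then have "g \<in> carrier G" "h \<in> carrier G" "x \<in> carrier G"
      using subgroup.mem_carrier[OF C] subgroup.mem_carrier[OF A] by auto
    moreover have "g \<otimes> (h \<otimes> x \<otimes> inv h) \<otimes> inv g \<in> ?A"
      using eng by blast
    ultimately show ?case
      by (simp add: m_assoc inv_mult_group)
  qed
  have normal: "?A \<lhd> G\<lparr>carrier := ?C\<rparr>"
    by (rule C.normal_invI[OF subgroup_incl[OF A C AC]]) (use N m_inv_consistent[OF C] in auto)
  have "\<exists>a\<in>?A. \<exists>b\<in>?B. x = a \<otimes> b" if "x \<in> ?C" for x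
    using that
  proof induction
    case one
    then show ?case
      by (intro bexI[of _ \<one>]) (auto intro: generate.one)
  next
    case (incl h)
    then have "h \<in> carrier G" "h \<in> ?A \<or> h \<in> ?B" using S T by (auto intro: generate.incl)
    then show ?case
      using generate.one[of G T] generate.one[of G S] l_one r_one by metis
  next
    case (inv h)
    then have "inv h \<in> carrier G" "inv h \<in> ?A \<or> inv h \<in> ?B" using S T by (auto intro: generate.inv)
    then show ?case
      using generate.one[of G T] generate.one[of G S] l_one r_one by metis
  next
    case (eng x y)
    then obtain a b a' b' where ab: "a \<in> ?A" "b \<in> ?B" "x = a \<otimes> b" "a' \<in> ?A" "b' \<in> ?B" "y = a' \<otimes> b'"
      by metis
    then have c: "a \<in> carrier G" "b \<in> carrier G" "a' \<in> carrier G" "b' \<in> carrier G"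
      using subgroup.mem_carrier[OF A] subgroup.mem_carrier[OF B] by auto
    have "a \<otimes> (b \<otimes> a' \<otimes> inv b) \<in> ?A" "b \<otimes> b' \<in> ?B"
      using ab BC N by (auto intro: generate.eng)
    moreover have "x \<otimes> y = (a \<otimes> (b \<otimes> a' \<otimes> inv b)) \<otimes> (b \<otimes> b')"
      using c ab by (simp add: m_assoc inv_cancel_left)
    ultimately show ?case by blast
  qed
  then have "?A <#>\<^bsub>G\<lparr>carrier := ?C\<rparr>\<^esub> ?B = ?C"
    using AC BC by (auto simp: set_mult_def intro!: generate.eng)
  moreover have "?A \<inter> ?B = {\<one>}"
    using int by (auto intro: generate.one)
  ultimately show ?thesis
    using normal subgroup_incl[OF B C BC] by (simp add: is_semidirect_def)
qed


section \<open>Words in free groups\<close>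

lemma free_group_carrier: "w \<in> carrier (free_group X) \<longleftrightarrow> reduced w \<and> set w \<subseteq> X \<times> UNIV"
  by (simp add: free_group_def)

lemma free_group_mult: "u \<otimes>\<^bsub>free_group X\<^esub> v = foldr push u v"
  by (simp add: free_group_def)

lemma free_group_one: "\<one>\<^bsub>free_group X\<^esub> = []"
  by (simp add: free_group_def)

lemma reduced_Nil [simp]: "reduced []"
  by (simp add: reduced_def)

lemma reduced_Cons:
  "reduced (l # w) \<longleftrightarrow> reduced w \<and> (w = [] \<or> \<not> cancels l (hd w))"
  by (auto simp: reduced_def successively_Cons)

lemma reduced_append:
  "reduced (u @ v) \<longleftrightarrow> reduced u \<and> reduced v \<and> (u = [] \<or> v = [] \<or> \<not> cancels (last u) (hd v))"
  by (auto simp: reduced_def successively_append_iff)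

lemma reduced_rev: "reduced (rev w) \<longleftrightarrow> reduced w"
  by (auto simp: reduced_def cancels_def elim!: successively_mono)

lemma foldr_push_append: "reduced (u @ v) \<Longrightarrow> foldr push u v = u @ v"
proof (induction u)
  case (Cons l u)
  then have "reduced (u @ v)" "reduced (l # (u @ v))"
    by (simp_all add: reduced_Cons)
  with Cons.IH show ?case
    by (simp add: push_reduced)
qed simp

lemma free_group_mult_append: "reduced (u @ v) \<Longrightarrow> u \<otimes>\<^bsub>free_group X\<^esub> v = u @ v"
  by (simp add: free_group_mult foldr_push_append)

lemma length_foldr_push: "length (foldr push u v) \<le> length u + length v"
proof (induction u)
  case (Cons l u)
  have "length (push l w) \<le> Suc (length w)" for w :: "'a word"
    by (cases w) auto
  from this[of "foldr push u v"] Cons show ?case by simp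
qed simp

lemma free_gen_closed [simp]: "free_gen a \<in> carrier (free_group X) \<longleftrightarrow> a \<in> X"
  by (auto simp: free_group_carrier free_gen_def reduced_Cons)

lemma free_group_inv: "w \<in> carrier (free_group X) \<Longrightarrow> inv\<^bsub>free_group X\<^esub> w = word_inv w"
proof (rule group.inv_equality[OF group_free_group])
  assume w: "w \<in> carrier (free_group X)"
  then show "word_inv w \<in> carrier (free_group X)"
    by (auto simp: free_group_carrier reduced_word_inv) (auto simp: word_inv_def)
  show "word_inv w \<otimes>\<^bsub>free_group X\<^esub> w = \<one>\<^bsub>free_group X\<^esub>"
    using w foldr_push_word_inv[of "[]" w] foldr_push_Nil[of w]
    by (simp add: free_group_mult free_group_one free_group_carrier)
qed

lemma free_group_inv_gen: "a \<in> X \<Longrightarrow> inv\<^bsub>free_group X\<^esub> free_gen a = [(a, False)]"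
  by (simp add: free_group_inv) (simp add: free_gen_def word_inv_def)

lemma free_group_Cons:
  assumes "a \<in> X" "(a, b) # w \<in> carrier (free_group X)"
  shows "(a, b) # w = (if b then free_gen a else inv\<^bsub>free_group X\<^esub> free_gen a) \<otimes>\<^bsub>free_group X\<^esub> w"
  using assms
  by (auto simp: free_group_inv_gen free_group_mult push_reduced free_group_carrier)
    (auto simp: free_gen_def push_reduced)

lemma free_group_induct [consumes 1, case_names one gen inv_gen]:
  assumes "w \<in> carrier (free_group X)"
    and "P \<one>\<^bsub>free_group X\<^esub>"
    and "\<And>a w. a \<in> X \<Longrightarrow> w \<in> carrier (free_group X) \<Longrightarrow> P w \<Longrightarrow> P (free_gen a \<otimes>\<^bsub>free_group X\<^esub> w)"
    and "\<And>a w. a \<in> X \<Longrightarrow> w \<in> carrier (free_group X) \<Longrightarrow> P w \<Longrightarrow>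
           P (inv\<^bsub>free_group X\<^esub> free_gen a \<otimes>\<^bsub>free_group X\<^esub> w)"
  shows "P w"
  using assms(1)
proof (induction w)
  case Nil
  then show ?case using assms(2) by (simp add: free_group_one)
next
  case (Cons l w)
  obtain a b where l: "l = (a, b)" by (cases l)
  have "a \<in> X" "w \<in> carrier (free_group X)"
    using Cons.prems by (auto simp: l free_group_carrier reduced_Cons)
  moreover have "P w" using Cons.IH calculation by blast
  ultimately show ?case
    using free_group_Cons[of a X b w] Cons.prems assms(3,4)[of a w] by (simp add: l)
qed

lemma free_group_hom_eq:
  assumes "group H" "g \<in> hom (free_group X) H" "h \<in> hom (free_group X) H"
    and eq: "\<And>a. a \<in> X \<Longrightarrow> g (free_gen a) = h (free_gen a)"
    and "w \<in> carrier (free_group X)"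
  shows "g w = h w"
proof -
  interpret F: group "free_group X" by (rule group_free_group)
  interpret H: group H by fact
  interpret g: group_hom "free_group X" H g by unfold_locales fact
  interpret h: group_hom "free_group X" H h by unfold_locales fact
  show ?thesis
    using assms(5) by (induction w rule: free_group_induct) (simp_all add: eq)
qed

lemma generate_free_gen: "generate (free_group X) (free_gen ` X) = carrier (free_group X)"
proof -
  interpret F: group "free_group X" by (rule group_free_group)
  have "w \<in> generate (free_group X) (free_gen ` X)" if "w \<in> carrier (free_group X)" for w
    using that
    by (induction w rule: free_group_induct) (auto intro: generate.intros)
  then show ?thesis
    using F.generate_incl[of "free_gen ` X"] by (simp add: image_subset_iff subset_antisym subsetI)
qed

lemma word_inv_Nil [simp]: "word_inv [] = []"
  and word_inv_Cons: "word_inv (l # w) = word_inv w @ [(fst l, \<not> snd l)]"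
  and word_inv_append: "word_inv (u @ v) = word_inv v @ word_inv u"
  and word_inv_word_inv [simp]: "word_inv (word_inv w) = w"
  and length_word_inv [simp]: "length (word_inv w) = length w"
  by (auto simp: word_inv_def case_prod_beta rev_map o_def)

text \<open>
  The letters cancelled in a product of reduced words form a suffix \<open>s\<close> of the first word and the
  inverse prefix of the second. What matters below is whether \<open>s\<close> can be
  the whole first word.
\<close>

lemma foldr_push_cancellation:
  assumes "reduced u" "reduced v"
  shows "\<exists>p s q. u = p @ s \<and> v = word_inv s @ q \<and> foldr push u v = p @ q"
  using assms(1)
proof (induction u)
  case Nil
  show ?case by (intro exI[of _ "[]"] exI[of _ v]) simp
next
  case (Cons l u)
  then obtain p s q where psq: "u = p @ s" "v = word_inv s @ q" "foldr push u v = p @ q"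
    by (auto simp: reduced_Cons)
  show ?case
  proof (cases "p = [] \<and> q \<noteq> [] \<and> cancels l (hd q)")
    case True
    then obtain q' where q: "q = (fst l, \<not> snd l) # q'"
      by (cases q) (auto simp: cancels_def prod_eq_iff)
    show ?thesis
      using True psq q
      by (intro exI[of _ "[]"] exI[of _ "l # u"] exI[of _ q']) (auto simp: word_inv_Cons cancels_def)
  next
    case False
    have "push l (p @ q) = l # p @ q"
      using False Cons.prems psq by (cases p; cases q) (auto simp: reduced_Cons)
    then show ?thesis
      using psq by (intro exI[of _ "l # p"] exI[of _ s] exI[of _ q]) auto
  qed
qed

lemma xg_nat_pow: "xg m [^]\<^bsub>free_group X\<^esub> (k::nat) = replicate k (m, True)"
proof (induction k)
  case 0
  show ?case by (simp add: free_group_one)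
next
  case (Suc k)
  have "reduced (replicate j (m, True))" for j
  proof (induction j)
    case (Suc j)
    then show ?case by (cases j) (simp_all add: reduced_Cons cancels_def)
  qed simp
  from this[of "Suc k"] have "reduced (replicate k (m, True) @ [(m, True)])"
    by (simp add: replicate_append_same)
  then show ?case
    using Suc by (simp add: nat_pow_def free_group_mult_append replicate_append_same free_gen_def)
qed

text \<open>
  For a positive exponent the two sides are distinct reduced words, as they start with different
  letters; a negative exponent is reduced to this case by inverting the power.
\<close>

lemma xg_int_pow_commute:
  assumes "m \<in> X" "l \<in> X" "l \<noteq> m"
    and "xg m [^]\<^bsub>free_group X\<^esub> (k::int) \<otimes>\<^bsub>free_group X\<^esub> xg l = xg l \<otimes>\<^bsub>free_group X\<^esub> xg m [^]\<^bsub>free_group X\<^esub> k"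
  shows "k = 0"
proof -
  interpret F: group "free_group X" by (rule group_free_group)
  have x: "xg m \<in> carrier (free_group X)" "xg l \<in> carrier (free_group X)"
    using assms by simp_all
  have nat: "j = 0" if eq: "xg m [^]\<^bsub>free_group X\<^esub> j \<otimes>\<^bsub>free_group X\<^esub> xg l = xg l \<otimes>\<^bsub>free_group X\<^esub> xg m [^]\<^bsub>free_group X\<^esub> j" for j :: nat
  proof (rule ccontr)
    assume "j \<noteq> 0"
    have "reduced (replicate j (m, True))"
      using F.nat_pow_closed[OF x(1), of j] by (simp add: xg_nat_pow free_group_carrier)
    then have "reduced (replicate j (m, True) @ xg l)" "reduced (xg l @ replicate j (m, True))"
      using assms(3) \<open>j \<noteq> 0\<close> by (auto simp: reduced_append free_gen_def reduced_Cons cancels_def)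
    then have "replicate j (m, True) @ xg l = xg l @ replicate j (m, True)"
      using eq by (simp add: xg_nat_pow free_group_mult_append)
    then show False
      using assms(3) \<open>j \<noteq> 0\<close> by (cases j) (auto simp: free_gen_def)
  qed
  show ?thesis
  proof (cases k)
    case (nonneg j)
    then show ?thesis using nat[of j] assms(4) by (simp add: int_pow_int)
  next
    case (neg j)
    define p where "p = xg m [^]\<^bsub>free_group X\<^esub> Suc j"
    have p: "p \<in> carrier (free_group X)" using x by (simp add: p_def del: nat_pow_Suc)
    have "inv\<^bsub>free_group X\<^esub> p \<otimes>\<^bsub>free_group X\<^esub> xg l = xg l \<otimes>\<^bsub>free_group X\<^esub> inv\<^bsub>free_group X\<^esub> p"
      using assms(4) x unfolding neg p_def by (simp only: F.int_pow_neg_int)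
    then have "p \<otimes>\<^bsub>free_group X\<^esub> (inv\<^bsub>free_group X\<^esub> p \<otimes>\<^bsub>free_group X\<^esub> xg l) \<otimes>\<^bsub>free_group X\<^esub> p =
       p \<otimes>\<^bsub>free_group X\<^esub> (xg l \<otimes>\<^bsub>free_group X\<^esub> inv\<^bsub>free_group X\<^esub> p) \<otimes>\<^bsub>free_group X\<^esub> p"
      by simp
    then have "p \<otimes>\<^bsub>free_group X\<^esub> xg l = xg l \<otimes>\<^bsub>free_group X\<^esub> p"
      using p x by (simp add: F.m_assoc F.inv_cancel_left)
    then show ?thesis using nat[of "Suc j"] by (simp add: p_def)
  qed
qed

text \<open>
  The image of the induced homomorphism is always the subgroup generated by the \<open>f a\<close>, so only
  injectivity has to be checked.
\<close>

lemma freely_generatesI: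
  assumes "group G" "f \<in> I \<rightarrow> carrier G"
    and ker: "\<And>u. u \<in> carrier (free_group I) \<Longrightarrow> free_lift G f u = \<one>\<^bsub>G\<^esub> \<Longrightarrow> u = []"
  shows "freely_generates G I f"
proof -
  interpret G: group G by fact
  interpret F: group "free_group I" by (rule group_free_group)
  interpret h: group_hom "free_group I" G "free_lift G f"
    by unfold_locales (rule G.free_lift_hom[OF assms(2)])
  have gen: "free_lift G f (free_gen a) = f a" if "a \<in> I" for a
    using that assms(2) by (intro G.free_lift_gen) auto
  have "free_lift G f ` carrier (free_group I) = generate G (free_lift G f ` free_gen ` I)"
    using h.generate_img[of "free_gen ` I"] by (simp add: generate_free_gen image_subset_iff)
  also have "free_lift G f ` free_gen ` I = f ` I"
    by (auto simp: image_image gen)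
  finally have img: "free_lift G f ` carrier (free_group I) = generate G (f ` I)" .
  have "inj_on (free_lift G f) (carrier (free_group I))"
    using ker by (auto simp: h.inj_on_one_iff free_group_one)
  then have "free_lift G f \<in> iso (free_group I) (G\<lparr>carrier := generate G (f ` I)\<rparr>)"
    using img h.homh by (auto simp: iso_def bij_betw_def hom_def)
  then show ?thesis
    using gen by (auto simp: freely_generates_def)
qed

lemma freely_abelian_generatesI:
  assumes "group G" "h \<in> hom (free_Abelian_group I) G"
    and gen: "\<And>a. a \<in> I \<Longrightarrow> h (frag_of a) = f a"
    and ker: "\<And>c. Poly_Mapping.keys c \<subseteq> I \<Longrightarrow> h c = \<one>\<^bsub>G\<^esub> \<Longrightarrow> c = 0"
  shows "freely_abelian_generates G I f"
proof -
  interpret G: group G by fact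
  interpret A: group "free_Abelian_group I" by simp
  interpret h: group_hom "free_Abelian_group I" G h
    by unfold_locales fact
  have sub: "frag_of ` I \<subseteq> carrier (free_Abelian_group I)"
    by auto
  have "c \<in> generate (free_Abelian_group I) (frag_of ` I)" if "Poly_Mapping.keys c \<subseteq> I" for c
  proof (rule free_Abelian_group_induct[OF that])
    show "0 \<in> generate (free_Abelian_group I) (frag_of ` I)"
      using generate.one[of "free_Abelian_group I" "frag_of ` I"] by simp
    show "x - y \<in> generate (free_Abelian_group I) (frag_of ` I)"
      if "Poly_Mapping.keys y \<subseteq> I" "x \<in> generate (free_Abelian_group I) (frag_of ` I)"
        "y \<in> generate (free_Abelian_group I) (frag_of ` I)" for x y
      using that generate.eng[of x "free_Abelian_group I" "frag_of ` I" "- y"]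
        A.generate_m_inv_closed[OF sub, of y] by simp
  qed (simp add: generate.incl)
  then have "generate (free_Abelian_group I) (frag_of ` I) = carrier (free_Abelian_group I)"
    using A.generate_incl[OF sub] by auto
  then have "h ` carrier (free_Abelian_group I) = generate G (h ` frag_of ` I)"
    using h.generate_img[OF sub] by simp
  also have "h ` frag_of ` I = f ` I"
    by (auto simp: image_image gen)
  finally have img: "h ` carrier (free_Abelian_group I) = generate G (f ` I)" .
  have "inj_on h (carrier (free_Abelian_group I))"
    using ker by (auto simp: h.inj_on_one_iff)
  then have "h \<in> iso (free_Abelian_group I) (G\<lparr>carrier := generate G (f ` I)\<rparr>)"
    using img h.homh by (auto simp: iso_def bij_betw_def hom_def)
  then show ?thesis
    using gen by (auto simp: freely_abelian_generates_def)
qed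


section \<open>The group of basis-conjugating automorphisms\<close>

lemma Cb_carrier:
  "\<phi> \<in> carrier (Cb n) \<longleftrightarrow> \<phi> \<in> extensional (carrier (Fn n)) \<and> \<phi> \<in> hom (Fn n) (Fn n) \<and>
     bij_betw \<phi> (carrier (Fn n)) (carrier (Fn n)) \<and>
     (\<forall>i\<in>{1..n}. \<exists>f\<in>carrier (Fn n). \<phi> (xg i) = inv\<^bsub>Fn n\<^esub> f \<otimes>\<^bsub>Fn n\<^esub> xg i \<otimes>\<^bsub>Fn n\<^esub> f)"
  by (auto simp: Cb_def Aut_def AutoGroup_def auto_def Bij_def)

lemma Cb_one: "\<one>\<^bsub>Cb n\<^esub> = (\<lambda>x\<in>carrier (Fn n). x)"
  by (simp add: Cb_def Aut_def AutoGroup_def BijGroup_def)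

lemma Cb_one_apply: "x \<in> carrier (Fn n) \<Longrightarrow> \<one>\<^bsub>Cb n\<^esub> x = x"
  by (simp add: Cb_one)

lemma Cb_closed: "\<phi> \<in> carrier (Cb n) \<Longrightarrow> x \<in> carrier (Fn n) \<Longrightarrow> \<phi> x \<in> carrier (Fn n)"
  by (auto simp: Cb_carrier bij_betw_def)

lemma Cb_hom: "\<phi> \<in> carrier (Cb n) \<Longrightarrow> \<phi> \<in> hom (Fn n) (Fn n)"
  by (simp add: Cb_carrier)

lemma Cb_mult_compose:
  assumes "\<phi> \<in> carrier (Cb n)" "\<psi> \<in> carrier (Cb n)"
  shows "\<phi> \<otimes>\<^bsub>Cb n\<^esub> \<psi> = compose (carrier (Fn n)) \<psi> \<phi>"
proof -
  have "\<phi> \<in> Bij (carrier (Fn n))" "\<psi> \<in> Bij (carrier (Fn n))"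
    using assms by (simp_all add: Cb_carrier Bij_def)
  then show ?thesis
    by (simp add: Cb_def Aut_def AutoGroup_def BijGroup_def)
qed

lemma Cb_apply:
  assumes "\<phi> \<in> carrier (Cb n)" "\<psi> \<in> carrier (Cb n)" "x \<in> carrier (Fn n)"
  shows "(\<phi> \<otimes>\<^bsub>Cb n\<^esub> \<psi>) x = \<psi> (\<phi> x)"
  using assms by (simp add: Cb_mult_compose compose_def)

lemma Cb_hom_simps:
  assumes "\<phi> \<in> carrier (Cb n)" "x \<in> carrier (Fn n)"
  shows "y \<in> carrier (Fn n) \<Longrightarrow> \<phi> (x \<otimes>\<^bsub>Fn n\<^esub> y) = \<phi> x \<otimes>\<^bsub>Fn n\<^esub> \<phi> y"
    and "\<phi> (inv\<^bsub>Fn n\<^esub> x) = inv\<^bsub>Fn n\<^esub> \<phi> x"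
    and "\<phi> (x [^]\<^bsub>Fn n\<^esub> (k::int)) = \<phi> x [^]\<^bsub>Fn n\<^esub> k"
proof -
  interpret F: group "Fn n" by (rule group_free_group)
  interpret h: group_hom "Fn n" "Fn n" \<phi>
    by unfold_locales (rule Cb_hom[OF assms(1)])
  show "y \<in> carrier (Fn n) \<Longrightarrow> \<phi> (x \<otimes>\<^bsub>Fn n\<^esub> y) = \<phi> x \<otimes>\<^bsub>Fn n\<^esub> \<phi> y"
    "\<phi> (inv\<^bsub>Fn n\<^esub> x) = inv\<^bsub>Fn n\<^esub> \<phi> x"
    "\<phi> (x [^]\<^bsub>Fn n\<^esub> (k::int)) = \<phi> x [^]\<^bsub>Fn n\<^esub> k"
    using assms(2) by (simp_all add: h.hom_int_pow)
qed

lemma group_Cb: "group (Cb n)"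
proof (rule groupI)
  interpret F: group "Fn n" by (rule group_free_group)
  let ?C = "carrier (Fn n)"
  show one: "\<one>\<^bsub>Cb n\<^esub> \<in> carrier (Cb n)"
    using F.id_in_auto F.one_closed
    by (auto simp: Cb_carrier Cb_one auto_def Bij_def simp del: F.one_closed
        intro!: bexI[of _ "\<one>\<^bsub>Fn n\<^esub>"])
  show mult: "\<phi> \<otimes>\<^bsub>Cb n\<^esub> \<psi> \<in> carrier (Cb n)"
    if \<phi>: "\<phi> \<in> carrier (Cb n)" and \<psi>: "\<psi> \<in> carrier (Cb n)" for \<phi> \<psi>
  proof -
    have "\<exists>f\<in>?C. \<psi> (\<phi> (xg i)) = inv\<^bsub>Fn n\<^esub> f \<otimes>\<^bsub>Fn n\<^esub> xg i \<otimes>\<^bsub>Fn n\<^esub> f" if i: "i \<in> {1..n}" for i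
    proof -
      obtain f g where f: "f \<in> ?C" "\<phi> (xg i) = inv\<^bsub>Fn n\<^esub> f \<otimes>\<^bsub>Fn n\<^esub> xg i \<otimes>\<^bsub>Fn n\<^esub> f"
        and g: "g \<in> ?C" "\<psi> (xg i) = inv\<^bsub>Fn n\<^esub> g \<otimes>\<^bsub>Fn n\<^esub> xg i \<otimes>\<^bsub>Fn n\<^esub> g"
        using \<phi> \<psi> i unfolding Cb_carrier by metis
      then show ?thesis
        using i by (intro bexI[of _ "g \<otimes>\<^bsub>Fn n\<^esub> \<psi> f"])
          (simp_all add: Cb_hom_simps[OF \<psi>] Cb_closed[OF \<psi>] F.inv_mult_group F.m_assoc)
    qed
    then show ?thesis
      using \<phi> \<psi> unfolding Cb_mult_compose[OF \<phi> \<psi>]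
      by (auto simp: Cb_carrier F.hom_compose compose_eq bij_betw_compose)
  qed
  fix \<phi> assume \<phi>: "\<phi> \<in> carrier (Cb n)"
  have "\<phi> \<in> ?C \<rightarrow> ?C" "\<phi> \<in> extensional ?C"
    using \<phi> by (auto simp: Cb_carrier dest: bij_betw_imp_funcset)
  then show "\<one>\<^bsub>Cb n\<^esub> \<otimes>\<^bsub>Cb n\<^esub> \<phi> = \<phi>"
    using \<phi> one by (simp add: Cb_mult_compose) (simp add: Cb_one)
  obtain \<psi>' where \<psi>': "\<psi>' = restrict (inv_into ?C \<phi>) ?C" by blast
  have B: "\<phi> \<in> Bij ?C" using \<phi> by (simp add: Cb_carrier Bij_def)
  have inv: "\<psi>' (\<phi> x) = x" if "x \<in> ?C" for x
    using B that Cb_closed[OF \<phi> that] by (simp add: \<psi>' Bij_def bij_betw_def)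
  have hom: "\<psi>' \<in> hom (Fn n) (Fn n)"
    unfolding \<psi>' by (rule F.restrict_inv_into_hom[OF Cb_hom[OF \<phi>] B])
  have "\<exists>f\<in>?C. \<psi>' (xg i) = inv\<^bsub>Fn n\<^esub> f \<otimes>\<^bsub>Fn n\<^esub> xg i \<otimes>\<^bsub>Fn n\<^esub> f" if i: "i \<in> {1..n}" for i
  proof -
    \<comment> \<open>Applying \<open>\<phi>\<inverse>\<close> to \<open>\<phi> x\<^sub>i = f\<inverse> x\<^sub>i f\<close> exhibits \<open>\<phi>\<inverse> x\<^sub>i\<close> as a conjugate of \<open>x\<^sub>i\<close>.\<close>
    interpret h: group_hom "Fn n" "Fn n" \<psi>' by unfold_locales (rule hom)
    obtain f where f: "f \<in> ?C" "\<phi> (xg i) = inv\<^bsub>Fn n\<^esub> f \<otimes>\<^bsub>Fn n\<^esub> xg i \<otimes>\<^bsub>Fn n\<^esub> f"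
      using \<phi> i unfolding Cb_carrier by metis
    have "xg i = inv\<^bsub>Fn n\<^esub> \<psi>' f \<otimes>\<^bsub>Fn n\<^esub> \<psi>' (xg i) \<otimes>\<^bsub>Fn n\<^esub> \<psi>' f"
      using inv[of "xg i"] f i by simp
    then have "\<psi>' f \<otimes>\<^bsub>Fn n\<^esub> xg i \<otimes>\<^bsub>Fn n\<^esub> inv\<^bsub>Fn n\<^esub> \<psi>' f =
      \<psi>' f \<otimes>\<^bsub>Fn n\<^esub> (inv\<^bsub>Fn n\<^esub> \<psi>' f \<otimes>\<^bsub>Fn n\<^esub> \<psi>' (xg i) \<otimes>\<^bsub>Fn n\<^esub> \<psi>' f) \<otimes>\<^bsub>Fn n\<^esub> inv\<^bsub>Fn n\<^esub> \<psi>' f"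
      by metis
    then show ?thesis
      using i f by (intro bexI[of _ "inv\<^bsub>Fn n\<^esub> \<psi>' f"]) (simp_all add: F.m_assoc F.inv_cancel_left)
  qed
  then have "\<psi>' \<in> carrier (Cb n)"
    using hom restrict_inv_into_Bij[OF B] by (auto simp: Cb_carrier \<psi>' Bij_def)
  moreover have "\<psi>' \<otimes>\<^bsub>Cb n\<^esub> \<phi> = \<one>\<^bsub>Cb n\<^esub>"
    unfolding Cb_mult_compose[OF calculation \<phi>] Cb_one
    using B by (auto simp: \<psi>' compose_def Bij_def bij_betw_def f_inv_into_f fun_eq_iff)
  ultimately show "\<exists>\<psi>\<in>carrier (Cb n). \<psi> \<otimes>\<^bsub>Cb n\<^esub> \<phi> = \<one>\<^bsub>Cb n\<^esub>" by blast
  fix \<psi> \<chi> assume \<psi>: "\<psi> \<in> carrier (Cb n)" and \<chi>: "\<chi> \<in> carrier (Cb n)"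
  show "\<phi> \<otimes>\<^bsub>Cb n\<^esub> \<psi> \<otimes>\<^bsub>Cb n\<^esub> \<chi> = \<phi> \<otimes>\<^bsub>Cb n\<^esub> (\<psi> \<otimes>\<^bsub>Cb n\<^esub> \<chi>)"
    using \<phi> \<psi> \<chi> mult[OF \<phi> \<psi>] mult[OF \<psi> \<chi>] Cb_closed[OF \<phi>]
    by (auto simp: Cb_mult_compose compose_def)
qed

lemma Cb_eqI:
  assumes "\<phi> \<in> carrier (Cb n)" "\<psi> \<in> carrier (Cb n)"
    and "\<And>i. i \<in> {1..n} \<Longrightarrow> \<phi> (xg i) = \<psi> (xg i)"
  shows "\<phi> = \<psi>"
proof (rule extensionalityI)
  show "\<phi> \<in> extensional (carrier (Fn n))" "\<psi> \<in> extensional (carrier (Fn n))"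
    using assms(1,2) by (auto simp: Cb_carrier)
  show "\<phi> x = \<psi> x" if "x \<in> carrier (Fn n)" for x
    using free_group_hom_eq[OF group_free_group Cb_hom[OF assms(1)] Cb_hom[OF assms(2)]] assms(3) that
    by blast
qed

lemma Cb_inv_apply:
  assumes "\<phi> \<in> carrier (Cb n)" "x \<in> carrier (Fn n)"
  shows "\<phi> ((inv\<^bsub>Cb n\<^esub> \<phi>) x) = x" "(inv\<^bsub>Cb n\<^esub> \<phi>) (\<phi> x) = x"
proof -
  interpret C: group "Cb n" by (rule group_Cb)
  show "\<phi> ((inv\<^bsub>Cb n\<^esub> \<phi>) x) = x"
    using assms Cb_apply[OF C.inv_closed[OF assms(1)] assms, symmetric] by (simp add: Cb_one_apply)
  show "(inv\<^bsub>Cb n\<^esub> \<phi>) (\<phi> x) = x"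
    using assms Cb_apply[OF assms(1) C.inv_closed[OF assms(1)] assms(2), symmetric]
    by (simp add: Cb_one_apply)
qed

lemma endo_hom:
  assumes "\<And>l. l \<in> {1..n} \<Longrightarrow> g l \<in> carrier (Fn n)"
  shows "endo n g \<in> hom (Fn n) (Fn n)"
proof -
  interpret F: group "Fn n" by (rule group_free_group)
  have "free_lift (Fn n) g \<in> hom (Fn n) (Fn n)"
    using assms by (intro F.free_lift_hom) auto
  then show ?thesis
    by (auto simp: endo_def hom_def Pi_iff)
qed

lemma endo_gen:
  assumes "l \<in> {1..n}" "g l \<in> carrier (Fn n)"
  shows "endo n g (xg l) = g l"
  using assms by (simp add: endo_def group.free_lift_gen[OF group_free_group])

lemma endo_extensional: "endo n g \<in> extensional (carrier (Fn n))"
  by (simp add: endo_def)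

text \<open>
  An endomorphism given by its values on the generators is recognised as a known automorphism without
  first proving it bijective.
\<close>

lemma endo_eqI:
  assumes \<phi>: "\<phi> \<in> carrier (Cb n)" and g: "\<And>l. l \<in> {1..n} \<Longrightarrow> g l = \<phi> (xg l)"
  shows "endo n g = \<phi>"
proof (rule extensionalityI[OF endo_extensional])
  have c: "g l \<in> carrier (Fn n)" if "l \<in> {1..n}" for l
    using that \<phi> by (simp add: g Cb_closed)
  show "\<phi> \<in> extensional (carrier (Fn n))" using \<phi> by (simp add: Cb_carrier)
  show "endo n g x = \<phi> x" if "x \<in> carrier (Fn n)" for x
    by (rule free_group_hom_eq[OF group_free_group endo_hom[OF c] Cb_hom[OF \<phi>] _ that])
      (simp_all add: endo_gen c g[symmetric])
qed


section \<open>Conjugation by powers of a generator, and McCool's relations\<close>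

text \<open>
  The automorphism \<open>x\<^sub>l \<mapsto> x\<^sub>m\<^sup>-\<^sup>k x\<^sub>l x\<^sub>m\<^sup>k\<close> with \<open>k = c l\<close>; it is the product of the commuting powers of the
  \<open>eps n l m\<close> with exponents \<open>c l\<close>. The generator \<open>x\<^sub>m\<close> commutes with its powers and is fixed.
  Composition adds exponents, so this family provides the inverses of the \<open>eps n l m\<close>, their
  commutation, and the free abelian subgroup at once.
\<close>

definition conj_pow :: "nat \<Rightarrow> nat \<Rightarrow> (nat \<Rightarrow> int) \<Rightarrow> nat word \<Rightarrow> nat word" where
  "conj_pow n m c = endo n (\<lambda>l. inv\<^bsub>Fn n\<^esub> (xg m [^]\<^bsub>Fn n\<^esub> c l) \<otimes>\<^bsub>Fn n\<^esub> xg l \<otimes>\<^bsub>Fn n\<^esub> (xg m [^]\<^bsub>Fn n\<^esub> c l))"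

context
  fixes n m :: nat
  assumes m: "m \<in> {1..n}"
begin

interpretation F: group "Fn n" by (rule group_free_group)

lemma xg_m_closed: "xg m \<in> carrier (Fn n)"
  using m by simp

lemma conj_pow_hom: "conj_pow n m c \<in> hom (Fn n) (Fn n)"
  unfolding conj_pow_def using xg_m_closed by (intro endo_hom) simp

lemma conj_pow_gen:
  assumes "l \<in> {1..n}"
  shows "conj_pow n m c (xg l) =
    inv\<^bsub>Fn n\<^esub> (xg m [^]\<^bsub>Fn n\<^esub> c l) \<otimes>\<^bsub>Fn n\<^esub> xg l \<otimes>\<^bsub>Fn n\<^esub> (xg m [^]\<^bsub>Fn n\<^esub> c l)"
  unfolding conj_pow_def using assms xg_m_closed by (subst endo_gen) simp_all

lemma conj_pow_self: "conj_pow n m c (xg m) = xg m"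
  using conj_pow_gen[OF m] F.int_pow_conj_self[OF xg_m_closed] by simp

text \<open>
  \<open>x\<^sub>m\<close> is fixed by the second map, so the conjugating powers of \<open>x\<^sub>m\<close> simply multiply.
\<close>

lemma conj_pow_conj_pow:
  assumes "w \<in> carrier (Fn n)"
  shows "conj_pow n m d (conj_pow n m c w) = conj_pow n m (\<lambda>l. c l + d l) w"
proof -
  interpret d: group_hom "Fn n" "Fn n" "conj_pow n m d"
    by unfold_locales (rule conj_pow_hom)
  have "(conj_pow n m d \<circ> conj_pow n m c) w = conj_pow n m (\<lambda>l. c l + d l) w"
  proof (rule free_group_hom_eq[OF group_free_group _ conj_pow_hom _ assms])
    show "conj_pow n m d \<circ> conj_pow n m c \<in> hom (Fn n) (Fn n)"
      by (rule hom_compose[OF conj_pow_hom conj_pow_hom])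
    fix l assume l: "l \<in> {1..n}"
    show "(conj_pow n m d \<circ> conj_pow n m c) (xg l) = conj_pow n m (\<lambda>l. c l + d l) (xg l)"
      using l xg_m_closed
      by (simp add: conj_pow_gen conj_pow_self d.hom_int_pow F.int_pow_mult F.inv_mult_group F.m_assoc
          add.commute[of "c l"])
  qed
  then show ?thesis by simp
qed

lemma conj_pow_0:
  assumes "w \<in> carrier (Fn n)"
  shows "conj_pow n m (\<lambda>_. 0) w = w"
proof -
  have "conj_pow n m (\<lambda>_. 0) w = id w"
    using group_free_group conj_pow_hom _ _ assms
    by (rule free_group_hom_eq) (auto simp: conj_pow_gen hom_def)
  then show ?thesis by simp
qed

lemma conj_pow_closed: "w \<in> carrier (Fn n) \<Longrightarrow> conj_pow n m c w \<in> carrier (Fn n)"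
  using conj_pow_hom by (rule hom_in_carrier)

lemma conj_pow_Cb: "conj_pow n m c \<in> carrier (Cb n)"
proof -
  have "bij_betw (conj_pow n m c) (carrier (Fn n)) (carrier (Fn n))"
    by (rule bij_betw_byWitness[where f' = "conj_pow n m (\<lambda>l. - c l)"])
      (auto simp: conj_pow_conj_pow conj_pow_0 conj_pow_closed)
  moreover have "\<forall>i\<in>{1..n}. \<exists>f\<in>carrier (Fn n).
      conj_pow n m c (xg i) = inv\<^bsub>Fn n\<^esub> f \<otimes>\<^bsub>Fn n\<^esub> xg i \<otimes>\<^bsub>Fn n\<^esub> f"
    using conj_pow_gen xg_m_closed F.int_pow_closed by blast
  ultimately show ?thesis
    using conj_pow_hom by (simp add: Cb_carrier) (simp add: conj_pow_def endo_extensional)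
qed

lemma conj_pow_mult: "conj_pow n m c \<otimes>\<^bsub>Cb n\<^esub> conj_pow n m d = conj_pow n m (\<lambda>l. c l + d l)"
  by (rule Cb_eqI[of _ n])
    (simp_all add: conj_pow_Cb group.is_monoid[OF group_Cb] monoid.m_closed Cb_apply conj_pow_conj_pow)

lemma conj_pow_one: "conj_pow n m (\<lambda>_. 0) = \<one>\<^bsub>Cb n\<^esub>"
  using group.is_monoid[OF group_Cb]
  by (intro Cb_eqI[of _ n]) (simp_all add: conj_pow_Cb conj_pow_0 monoid.one_closed Cb_one_apply)

lemma conj_pow_inv: "inv\<^bsub>Cb n\<^esub> conj_pow n m c = conj_pow n m (\<lambda>l. - c l)"
  by (rule group.inv_equality[OF group_Cb]) (simp_all add: conj_pow_mult conj_pow_one conj_pow_Cb)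

end

lemma conj_pow_cong:
  assumes "\<And>l. l \<in> {1..n} \<Longrightarrow> l \<noteq> m \<Longrightarrow> c l = d l" "m \<in> {1..n}"
  shows "conj_pow n m c = conj_pow n m d"
proof (rule Cb_eqI)
  show "conj_pow n m c (xg i) = conj_pow n m d (xg i)" if "i \<in> {1..n}" for i
    using assms that by (cases "i = m") (simp_all add: conj_pow_self conj_pow_gen)
qed (use assms(2) in \<open>simp_all add: conj_pow_Cb\<close>)

lemma eps_conj_pow:
  assumes "i \<in> {1..n}" "j \<in> {1..n}"
  shows "eps n i j = conj_pow n j (\<lambda>l. of_bool (l = i))"
proof -
  interpret F: group "Fn n" by (rule group_free_group)
  show ?thesis
    unfolding eps_def using assms by (intro endo_eqI conj_pow_Cb) (auto simp: conj_pow_gen)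
qed

lemma eps_Cb [simp]: "i \<in> {1..n} \<Longrightarrow> j \<in> {1..n} \<Longrightarrow> eps n i j \<in> carrier (Cb n)"
  by (simp add: eps_conj_pow conj_pow_Cb)

lemma eps_gen:
  assumes "i \<in> {1..n}" "j \<in> {1..n}" "l \<in> {1..n}"
  shows "eps n i j (xg l) = (if l = i then inv\<^bsub>Fn n\<^esub> xg j \<otimes>\<^bsub>Fn n\<^esub> xg i \<otimes>\<^bsub>Fn n\<^esub> xg j else xg l)"
  unfolding eps_def using assms group.subgroup_self
  by (subst endo_gen) (auto intro!: monoid.m_closed group.inv_closed simp: group_free_group group.is_monoid)

lemma inv_eps_gen:
  assumes "i \<in> {1..n}" "j \<in> {1..n}" "l \<in> {1..n}"
  shows "(inv\<^bsub>Cb n\<^esub> eps n i j) (xg l) =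
    (if l = i then xg j \<otimes>\<^bsub>Fn n\<^esub> xg i \<otimes>\<^bsub>Fn n\<^esub> inv\<^bsub>Fn n\<^esub> xg j else xg l)"
proof -
  interpret F: group "Fn n" by (rule group_free_group)
  have "inv\<^bsub>Cb n\<^esub> eps n i j = conj_pow n j (\<lambda>l. - of_bool (l = i))"
    using assms by (simp add: eps_conj_pow conj_pow_inv)
  then show ?thesis
    using assms by (auto simp: conj_pow_gen F.int_pow_neg)
qed

lemma eps_commute_same:
  assumes "i \<in> {1..n}" "j \<in> {1..n}" "k \<in> {1..n}"
  shows "eps n i k \<otimes>\<^bsub>Cb n\<^esub> eps n j k = eps n j k \<otimes>\<^bsub>Cb n\<^esub> eps n i k"
  using assms by (simp add: eps_conj_pow conj_pow_mult add.commute)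

lemma eps_commute_disjoint:
  assumes "i \<in> {1..n}" "j \<in> {1..n}" "k \<in> {1..n}" "l \<in> {1..n}" "i \<noteq> k" "i \<noteq> l" "j \<noteq> k"
  shows "eps n i j \<otimes>\<^bsub>Cb n\<^esub> eps n k l = eps n k l \<otimes>\<^bsub>Cb n\<^esub> eps n i j"
proof (rule Cb_eqI)
  interpret F: group "Fn n" by (rule group_free_group)
  interpret C: group "Cb n" by (rule group_Cb)
  have e: "eps n i j \<in> carrier (Cb n)" "eps n k l \<in> carrier (Cb n)"
    using assms by simp_all
  then show "eps n i j \<otimes>\<^bsub>Cb n\<^esub> eps n k l \<in> carrier (Cb n)" "eps n k l \<otimes>\<^bsub>Cb n\<^esub> eps n i j \<in> carrier (Cb n)"
    by simp_all
  show "(eps n i j \<otimes>\<^bsub>Cb n\<^esub> eps n k l) (xg a) = (eps n k l \<otimes>\<^bsub>Cb n\<^esub> eps n i j) (xg a)" if "a \<in> {1..n}" for a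
    using that assms by (auto simp: Cb_apply[OF e] Cb_apply[OF e(2,1)] eps_gen Cb_hom_simps[OF e(1)]
        Cb_hom_simps[OF e(2)])
qed

text \<open>
  Together with the two commutation rules above this is McCool's list of relations. It holds because
  \<open>eps n i j\<close> followed by \<open>eps n k j\<close> conjugates both \<open>x\<^sub>i\<close> and \<open>x\<^sub>k\<close> by \<open>x\<^sub>j\<close>, hence acts on
  the subgroup generated by \<open>x\<^sub>i\<close>, \<open>x\<^sub>j\<close> and \<open>x\<^sub>k\<close> as conjugation by \<open>x\<^sub>j\<close>, which \<open>eps n i k\<close> fixes.
\<close>

lemma eps_McCool:
  assumes ijk: "i \<in> {1..n}" "j \<in> {1..n}" "k \<in> {1..n}" "i \<noteq> j" "i \<noteq> k" "j \<noteq> k"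
  shows "(eps n i j \<otimes>\<^bsub>Cb n\<^esub> eps n k j) \<otimes>\<^bsub>Cb n\<^esub> eps n i k = eps n i k \<otimes>\<^bsub>Cb n\<^esub> (eps n i j \<otimes>\<^bsub>Cb n\<^esub> eps n k j)"
proof (rule Cb_eqI)
  interpret F: group "Fn n" by (rule group_free_group)
  interpret C: group "Cb n" by (rule group_Cb)
  have e: "eps n i j \<in> carrier (Cb n)" "eps n k j \<in> carrier (Cb n)" "eps n i k \<in> carrier (Cb n)"
    using assms by simp_all
  then show "eps n i j \<otimes>\<^bsub>Cb n\<^esub> eps n k j \<otimes>\<^bsub>Cb n\<^esub> eps n i k \<in> carrier (Cb n)"
    "eps n i k \<otimes>\<^bsub>Cb n\<^esub> (eps n i j \<otimes>\<^bsub>Cb n\<^esub> eps n k j) \<in> carrier (Cb n)"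
    by simp_all
  show "(eps n i j \<otimes>\<^bsub>Cb n\<^esub> eps n k j \<otimes>\<^bsub>Cb n\<^esub> eps n i k) (xg a) =
      (eps n i k \<otimes>\<^bsub>Cb n\<^esub> (eps n i j \<otimes>\<^bsub>Cb n\<^esub> eps n k j)) (xg a)" if "a \<in> {1..n}" for a
    using that assms e
    by (auto simp: Cb_apply Cb_closed eps_gen Cb_hom_simps F.m_assoc F.inv_mult_group F.inv_cancel_left)
qed


section \<open>Generators of the basis-conjugating automorphisms\<close>

definition eps_upto :: "nat \<Rightarrow> nat \<Rightarrow> (nat word \<Rightarrow> nat word) set" where
  "eps_upto n m = {eps n i j | i j. i \<in> {1..m} \<and> j \<in> {1..m} \<and> i \<noteq> j}"

lemma eps_upto_subset: "m \<le> n \<Longrightarrow> eps_upto n m \<subseteq> carrier (Cb n)"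
  by (auto simp: eps_upto_def)

definition conjugators :: "nat \<Rightarrow> (nat word \<Rightarrow> nat word) \<Rightarrow> (nat \<Rightarrow> nat word) \<Rightarrow> bool" where
  "conjugators n \<phi> f \<longleftrightarrow> (\<forall>i\<in>{1..n}. f i \<in> carrier (Fn n) \<and>
     \<phi> (xg i) = inv\<^bsub>Fn n\<^esub> f i \<otimes>\<^bsub>Fn n\<^esub> xg i \<otimes>\<^bsub>Fn n\<^esub> f i)"

text \<open>
  The two conditions on the conjugators say that \<open>\<phi>\<close> cannot be shortened. Under them, in the image of a
  reduced word the middle letters \<open>x\<^sub>i\<^sup>\<plusminus>\<^sup>1\<close> of the factors \<open>f\<^sub>i\<inverse> x\<^sub>i\<^sup>\<plusminus>\<^sup>1 f\<^sub>i\<close> all survive, and so the image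
  starts with the uncancelled first half of its first factor.
\<close>

lemma Cb_image_prefix:
  assumes \<phi>: "\<phi> \<in> carrier (Cb n)" and f: "conjugators n \<phi> f"
    and start: "\<And>i b g. i \<in> {1..n} \<Longrightarrow> f i \<noteq> (i, b) # g"
    and suffix: "\<And>i j b g. i \<in> {1..n} \<Longrightarrow> j \<in> {1..n} \<Longrightarrow> i \<noteq> j \<Longrightarrow> f i \<noteq> g @ (j, b) # f j"
    and w: "(a, b) # w \<in> carrier (Fn n)"
  shows "\<exists>r. \<phi> ((a, b) # w) = word_inv (f a) @ (a, b) # r"
proof -
  interpret F: group "Fn n" by (rule group_free_group)
  have step: "\<exists>r. \<phi> ((a, b) # w) = word_inv (f a) @ (a, b) # r"
    if w: "(a, b) # w \<in> carrier (Fn n)"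
      and IH: "\<And>c d v. w = (c, d) # v \<Longrightarrow> \<exists>r. \<phi> w = word_inv (f c) @ (c, d) # r"
    for a b w
  proof -
    have a: "a \<in> {1..n}" and w': "w \<in> carrier (Fn n)" and red: "reduced ((a, b) # w)"
      using w by (auto simp: free_group_carrier reduced_Cons)
    have fa: "f a \<in> carrier (Fn n)" "\<phi> (xg a) = inv\<^bsub>Fn n\<^esub> f a \<otimes>\<^bsub>Fn n\<^esub> xg a \<otimes>\<^bsub>Fn n\<^esub> f a"
      using f a by (auto simp: conjugators_def)
    have rfa: "reduced (f a)" "reduced (word_inv (f a))"
      using fa by (auto simp: free_group_carrier reduced_word_inv)
    have V: "reduced ((a, b) # f a)" for b
    proof (cases "f a")
      case (Cons l g)
      then have "fst l \<noteq> a"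
        using start[OF a, of "snd l" g] by (cases l) auto
      then show ?thesis
        using Cons rfa by (simp add: reduced_Cons cancels_def)
    qed (simp add: reduced_Cons)
    have "reduced (word_inv ((a, \<not> b) # f a))"
      using V by (rule reduced_word_inv)
    then have V': "reduced (word_inv (f a) @ [(a, b)])"
      by (simp add: word_inv_Cons)
    define y where "y = (if b then xg a else inv\<^bsub>Fn n\<^esub> xg a)"
    have y: "y \<in> carrier (Fn n)" using a by (simp add: y_def)
    have \<phi>w: "\<phi> w \<in> carrier (Fn n)" using \<phi> w' by (rule Cb_closed)
    have c: "word_inv (f a) \<in> carrier (Fn n)" "(a, b) # f a \<in> carrier (Fn n)"
      using F.inv_closed[OF fa(1)] fa(1) V a by (auto simp: free_group_inv free_group_carrier)
    have "y \<otimes>\<^bsub>Fn n\<^esub> f a = (a, b) # f a"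
      using free_group_Cons[OF a c(2)] by (simp add: y_def)
    moreover have "\<phi> y = inv\<^bsub>Fn n\<^esub> f a \<otimes>\<^bsub>Fn n\<^esub> (y \<otimes>\<^bsub>Fn n\<^esub> f a)"
      using a fa by (simp add: y_def Cb_hom_simps[OF \<phi>] F.m_assoc F.inv_mult_group)
    ultimately have \<phi>y: "\<phi> y = word_inv (f a) \<otimes>\<^bsub>Fn n\<^esub> ((a, b) # f a)"
      using fa by (simp add: free_group_inv)
    have "(a, b) # w = y \<otimes>\<^bsub>Fn n\<^esub> w"
      using free_group_Cons[OF a w] by (simp add: y_def)
    then have \<phi>aw: "\<phi> ((a, b) # w) = word_inv (f a) \<otimes>\<^bsub>Fn n\<^esub> (((a, b) # f a) \<otimes>\<^bsub>Fn n\<^esub> \<phi> w)"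
      using y w' c \<phi>w by (simp add: Cb_hom_simps[OF \<phi>] \<phi>y F.m_assoc)
    \<comment> \<open>Everything comes down to the letter \<open>(a, b)\<close> not being cancelled, that is, to \<open>p \<noteq> []\<close>.\<close>
    obtain p s q where psq: "(a, b) # f a = p @ s" "\<phi> w = word_inv s @ q"
        "((a, b) # f a) \<otimes>\<^bsub>Fn n\<^esub> \<phi> w = p @ q"
      using foldr_push_cancellation[OF V, of "\<phi> w" b] \<phi>w
      unfolding free_group_mult free_group_carrier by blast
    have rpq: "reduced (p @ q)"
      using F.m_closed[OF c(2) \<phi>w] by (simp add: psq(3) free_group_carrier)
    have "p \<noteq> []"
    proof
      assume p: "p = []"
      then have "s = (a, b) # f a"
        using psq(1) by simp
      then have v: "\<phi> w = word_inv (f a) @ (a, \<not> b) # q"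
        using psq(2) by (simp add: word_inv_Cons)
      obtain l v where w_eq: "w = l # v"
      proof (cases w)
        case Nil
        then have "\<phi> w = []"
          using group_hom.hom_one[of "Fn n" "Fn n" \<phi>] Cb_hom[OF \<phi>]
          by (simp add: free_group_one group_hom_def group_hom_axioms_def group_free_group)
        then show ?thesis using v by simp
      qed
      obtain c d where l: "l = (c, d)" by (cases l)
      have c: "c \<in> {1..n}" "(c, d) \<noteq> (a, \<not> b)"
        using w' red by (auto simp: w_eq l free_group_carrier reduced_Cons cancels_def)
      obtain r where r: "\<phi> w = word_inv (f c) @ (c, d) # r"
        using IH[of c d v] w_eq l by blast
      \<comment> \<open>Now \<open>\<phi> w\<close> starts both with \<open>f\<^sub>a\<inverse> x\<^sub>a\<close>, up to the sign of \<open>x\<^sub>a\<close>, and with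
        \<open>f\<^sub>c\<inverse> x\<^sub>c\<close>, up to the sign of \<open>x\<^sub>c\<close>, so one of these words is a prefix of the other. A
        proper prefix would give a forbidden suffix of \<open>f\<^sub>a\<close> or of \<open>f\<^sub>c\<close>.\<close>
      have no_prefix: False
        if "word_inv (f i) = word_inv (f j) @ (j, e) # us" "i \<in> {1..n}" "j \<in> {1..n}" for i j e us
      proof -
        have "f i = word_inv (word_inv (f j) @ (j, e) # us)"
          by (simp flip: that(1))
        then have *: "f i = word_inv us @ (j, \<not> e) # f j"
          by (simp add: word_inv_append word_inv_Cons)
        show False
        proof (cases "i = j")
          case True
          then have "length (f i) = length (word_inv us @ (j, \<not> e) # f i)"
            using * by metis
          then show False by simp
        qed (use * suffix that in blast)
      qed
      from v r have "word_inv (f a) @ (a, \<not> b) # q = word_inv (f c) @ (c, d) # r" by simp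
      then obtain us where
        "word_inv (f a) = word_inv (f c) @ us \<and> us @ (a, \<not> b) # q = (c, d) # r \<or>
         word_inv (f a) @ us = word_inv (f c) \<and> (a, \<not> b) # q = us @ (c, d) # r"
        unfolding append_eq_append_conv2 by blast
      then show False
        using no_prefix[OF _ a c(1)] no_prefix[OF _ c(1) a] c(2) by (cases us) (auto, metis+)
    qed
    then obtain p' where p': "p = (a, b) # p'"
      using psq(1) by (cases p) auto
    have "reduced (word_inv (f a) @ (a, b) # (p' @ q))"
      using V' rpq by (auto simp: p' reduced_append reduced_Cons)
    then have "\<phi> ((a, b) # w) = word_inv (f a) @ (a, b) # (p' @ q)"
      using \<phi>aw psq(3) p' by (simp add: free_group_mult_append)
    then show "\<exists>r. \<phi> ((a, b) # w) = word_inv (f a) @ (a, b) # r" by blast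
  qed
  from w show ?thesis
  proof (induction w arbitrary: a b)
    case Nil
    then show ?case by (rule step) simp
  next
    case (Cons l w)
    from Cons.prems show ?case
    proof (rule step)
      fix c d v assume eq: "l # w = (c, d) # v"
      then have "(c, d) # w \<in> carrier (Fn n)"
        using Cons.prems by (auto simp: free_group_carrier reduced_Cons)
      then show "\<exists>r. \<phi> (l # w) = word_inv (f c) @ (c, d) # r"
        using Cons.IH eq by simp
    qed
  qed
qed

text \<open>
  Each \<open>x\<^sub>k\<close> is the image of some word, and by the previous lemma that image starts with \<open>f\<^sub>a\<inverse> x\<^sub>a\<^sup>\<plusminus>\<^sup>1\<close>.
  A word of length one leaves no room for \<open>f\<^sub>a\<close>, so \<open>a = k\<close> and \<open>f\<^sub>k\<close> is trivial.
\<close>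

lemma Cb_irreducible_one:
  assumes \<phi>: "\<phi> \<in> carrier (Cb n)" and f: "conjugators n \<phi> f"
    and start: "\<And>i b g. i \<in> {1..n} \<Longrightarrow> f i \<noteq> (i, b) # g"
    and suffix: "\<And>i j b g. i \<in> {1..n} \<Longrightarrow> j \<in> {1..n} \<Longrightarrow> i \<noteq> j \<Longrightarrow> f i \<noteq> g @ (j, b) # f j"
  shows "\<phi> = \<one>\<^bsub>Cb n\<^esub>"
proof (rule Cb_eqI)
  interpret F: group "Fn n" by (rule group_free_group)
  interpret C: group "Cb n" by (rule group_Cb)
  interpret \<phi>: group_hom "Fn n" "Fn n" \<phi>
    by unfold_locales (rule Cb_hom[OF \<phi>])
  show "\<phi> \<in> carrier (Cb n)" "\<one>\<^bsub>Cb n\<^esub> \<in> carrier (Cb n)"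
    using \<phi> by simp_all
  fix k assume k: "k \<in> {1..n}"
  then have "xg k \<in> \<phi> ` carrier (Fn n)"
    using \<phi> by (simp add: Cb_carrier bij_betw_def)
  then obtain u where u: "u \<in> carrier (Fn n)" "\<phi> u = [(k, True)]"
    by (auto simp: free_gen_def)
  then have "u \<noteq> []"
    using \<phi>.hom_one by (auto simp: free_group_one)
  then obtain a b w where "u = (a, b) # w" by (cases u) auto
  then obtain r where "[(k, True)] = word_inv (f a) @ (a, b) # r"
    using Cb_image_prefix[OF \<phi> f start suffix] u by metis
  then have "word_inv (f k) = []"
    by (cases "word_inv (f a)") auto
  then have "f k = \<one>\<^bsub>Fn n\<^esub>"
    by (metis word_inv_Nil word_inv_word_inv free_group_one)
  then show "\<phi> (xg k) = \<one>\<^bsub>Cb n\<^esub> (xg k)"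
    using f k by (simp add: conjugators_def Cb_one_apply)
qed

text \<open>
  Descent on the total length of the conjugators: an \<open>x\<^sub>i\<^sup>\<plusminus>\<^sup>1\<close> at the start of \<open>f\<^sub>i\<close> can be dropped, and a
  suffix \<open>x\<^sub>j\<^sup>\<plusminus>\<^sup>1 f\<^sub>j\<close> of \<open>f\<^sub>i\<close> is shortened by multiplying \<open>\<phi>\<close> with \<open>eps n i j\<close> or its inverse.
\<close>

lemma conjugators_imp_generate:
  assumes "\<phi> \<in> carrier (Cb n)" "conjugators n \<phi> f"
  shows "\<phi> \<in> generate (Cb n) (eps_upto n n)"
  using assms
proof (induction "\<Sum>i\<in>{1..n}. length (f i)" arbitrary: \<phi> f rule: less_induct)
  case less
  interpret F: group "Fn n" by (rule group_free_group)
  interpret C: group "Cb n" by (rule group_Cb)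
  have f: "f i \<in> carrier (Fn n)" "\<phi> (xg i) = inv\<^bsub>Fn n\<^esub> f i \<otimes>\<^bsub>Fn n\<^esub> xg i \<otimes>\<^bsub>Fn n\<^esub> f i" if "i \<in> {1..n}" for i
    using less.prems(2) that by (auto simp: conjugators_def)
  have shorter: "\<psi> \<in> generate (Cb n) (eps_upto n n)"
    if "\<psi> \<in> carrier (Cb n)" "conjugators n \<psi> (f(i := g))" "i \<in> {1..n}" "length g < length (f i)" for \<psi> i g
    using that by (intro less.hyps[of "f(i := g)"] sum_strict_mono_ex1) auto
  consider (start) i b g where "i \<in> {1..n}" "f i = (i, b) # g"
    | (suffix) i j b g where "i \<in> {1..n}" "j \<in> {1..n}" "i \<noteq> j" "f i = g @ (j, b) # f j"
    | (one) "\<phi> = \<one>\<^bsub>Cb n\<^esub>"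
    using Cb_irreducible_one[OF less.prems] by blast
  then show ?case
  proof cases
    case start
    then have g: "g \<in> carrier (Fn n)"
      using f(1)[of i] by (auto simp: free_group_carrier reduced_Cons)
    have eq: "f i = (if b then xg i else inv\<^bsub>Fn n\<^esub> xg i) \<otimes>\<^bsub>Fn n\<^esub> g"
      using f(1)[of i] free_group_Cons[of i _ b g] start by metis
    have "\<phi> (xg i) = inv\<^bsub>Fn n\<^esub> g \<otimes>\<^bsub>Fn n\<^esub> xg i \<otimes>\<^bsub>Fn n\<^esub> g"
      using start(1) g unfolding f(2)[OF start(1)] eq
      by (simp add: F.m_assoc F.inv_mult_group F.inv_cancel_left)
    then have "conjugators n \<phi> (f(i := g))"
      using f g unfolding conjugators_def by (metis fun_upd_apply)
    then show ?thesis
      using less.prems(1) start by (intro shorter[of \<phi> i g]) simp_all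
  next
    case suffix
    \<comment> \<open>If \<open>f\<^sub>i = g y f\<^sub>j\<close> with \<open>y = x\<^sub>j\<^sup>\<plusminus>\<^sup>1\<close>, then \<open>f\<^sub>i \<phi>(y)\<inverse> = g f\<^sub>j\<close>. So conjugating \<open>x\<^sub>i\<close> by
      \<open>y\<inverse>\<close> first removes the letter \<open>y\<close>.\<close>
    define e where "e = (if b then inv\<^bsub>Cb n\<^esub> eps n i j else eps n i j)"
    define y where "y = (if b then xg j else inv\<^bsub>Fn n\<^esub> xg j)"
    have e: "e \<in> carrier (Cb n)" and y: "y \<in> carrier (Fn n)"
      using suffix by (simp_all add: e_def y_def)
    have "reduced (g @ ((j, b) # f j))" "g \<in> carrier (Fn n)" "(j, b) # f j \<in> carrier (Fn n)"
      using f(1)[of i] suffix by (auto simp: free_group_carrier reduced_append)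
    then have g: "g \<in> carrier (Fn n)" and fi: "f i = g \<otimes>\<^bsub>Fn n\<^esub> (y \<otimes>\<^bsub>Fn n\<^esub> f j)"
      using free_group_Cons[of j _ b "f j"] suffix by (simp_all add: free_group_mult_append y_def)
    have ei: "e (xg i) = y \<otimes>\<^bsub>Fn n\<^esub> xg i \<otimes>\<^bsub>Fn n\<^esub> inv\<^bsub>Fn n\<^esub> y"
      and el: "e (xg l) = xg l" if "l \<in> {1..n}" "l \<noteq> i" for l
      using suffix that by (simp_all add: e_def y_def eps_gen inv_eps_gen)
    have \<phi>y: "\<phi> y = inv\<^bsub>Fn n\<^esub> f j \<otimes>\<^bsub>Fn n\<^esub> y \<otimes>\<^bsub>Fn n\<^esub> f j"
      using suffix f[of j] by (simp add: y_def Cb_hom_simps[OF less.prems(1)] F.m_assoc F.inv_mult_group)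
    have "conjugators n (e \<otimes>\<^bsub>Cb n\<^esub> \<phi>) (f(i := g \<otimes>\<^bsub>Fn n\<^esub> f j))"
      unfolding conjugators_def
    proof
      fix l assume l: "l \<in> {1..n}"
      show "(f(i := g \<otimes>\<^bsub>Fn n\<^esub> f j)) l \<in> carrier (Fn n) \<and> (e \<otimes>\<^bsub>Cb n\<^esub> \<phi>) (xg l) =
        inv\<^bsub>Fn n\<^esub> (f(i := g \<otimes>\<^bsub>Fn n\<^esub> f j)) l \<otimes>\<^bsub>Fn n\<^esub> xg l \<otimes>\<^bsub>Fn n\<^esub> (f(i := g \<otimes>\<^bsub>Fn n\<^esub> f j)) l"
      proof (cases "l = i")
        case True
        have "\<phi> (e (xg i)) = \<phi> y \<otimes>\<^bsub>Fn n\<^esub> \<phi> (xg i) \<otimes>\<^bsub>Fn n\<^esub> inv\<^bsub>Fn n\<^esub> \<phi> y"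
          using suffix y by (simp add: ei Cb_hom_simps[OF less.prems(1)])
        also have "\<dots> = inv\<^bsub>Fn n\<^esub> (g \<otimes>\<^bsub>Fn n\<^esub> f j) \<otimes>\<^bsub>Fn n\<^esub> xg i \<otimes>\<^bsub>Fn n\<^esub> (g \<otimes>\<^bsub>Fn n\<^esub> f j)"
          using suffix(1,2) y g f(1)[of j] unfolding f(2)[OF suffix(1)] \<phi>y fi
          by (simp add: F.m_assoc F.inv_mult_group F.inv_cancel_left)
        finally show ?thesis
          using True suffix(1,2) g f(1)[of j] by (simp add: Cb_apply[OF e less.prems(1)])
      next
        case False
        then show ?thesis
          using l f[of l] el[of l] by (simp add: Cb_apply[OF e less.prems(1)])
      qed
    qed
    moreover have "length (g \<otimes>\<^bsub>Fn n\<^esub> f j) < length (f i)"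
      using length_foldr_push[of g "f j"] suffix by (simp add: free_group_mult)
    ultimately have "e \<otimes>\<^bsub>Cb n\<^esub> \<phi> \<in> generate (Cb n) (eps_upto n n)"
      using e less.prems(1) suffix by (intro shorter) auto
    moreover have "eps n i j \<in> eps_upto n n"
      using suffix by (auto simp: eps_upto_def)
    then have "inv\<^bsub>Cb n\<^esub> e \<in> generate (Cb n) (eps_upto n n)"
      using suffix by (auto simp: e_def intro: generate.intros)
    ultimately have "inv\<^bsub>Cb n\<^esub> e \<otimes>\<^bsub>Cb n\<^esub> (e \<otimes>\<^bsub>Cb n\<^esub> \<phi>) \<in> generate (Cb n) (eps_upto n n)"
      by (rule generate.eng[rotated])
    then show ?thesis
      using e less.prems(1) by (simp add: C.inv_cancel_left)
  qed (simp add: generate.one)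
qed

theorem Cb_generated_by_eps: "generate (Cb n) (eps_upto n n) = carrier (Cb n)"
proof
  interpret C: group "Cb n" by (rule group_Cb)
  show "generate (Cb n) (eps_upto n n) \<subseteq> carrier (Cb n)"
    by (intro C.generate_incl eps_upto_subset) simp
  show "carrier (Cb n) \<subseteq> generate (Cb n) (eps_upto n n)"
  proof
    fix \<phi> assume \<phi>: "\<phi> \<in> carrier (Cb n)"
    then have "\<exists>f. \<forall>i\<in>{1..n}. f i \<in> carrier (Fn n) \<and>
        \<phi> (xg i) = inv\<^bsub>Fn n\<^esub> f i \<otimes>\<^bsub>Fn n\<^esub> xg i \<otimes>\<^bsub>Fn n\<^esub> f i"
      by (intro bchoice) (auto simp: Cb_carrier)
    then show "\<phi> \<in> generate (Cb n) (eps_upto n n)"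
      using conjugators_imp_generate[OF \<phi>] by (auto simp: conjugators_def)
  qed
qed


section \<open>The iterated semidirect product\<close>

definition Dsub_gens :: "nat \<Rightarrow> nat \<Rightarrow> (nat word \<Rightarrow> nat word) set" where
  "Dsub_gens n i = (\<lambda>j. eps n (i + 1) j) ` {1..i} \<union> (\<lambda>j. eps n j (i + 1)) ` {1..i}"

lemma Dsub_eq_generate: "Dsub n i = generate (Cb n) (Dsub_gens n i)"
  by (simp add: Dsub_def Dsub_gens_def)

lemma Dsub_gens_subset: "i + 1 \<le> n \<Longrightarrow> Dsub_gens n i \<subseteq> carrier (Cb n)"
  by (auto simp: Dsub_gens_def)

lemma eps_in_Dsub_gens:
  assumes "1 \<le> j" "j \<le> i"
  shows "eps n (i + 1) j \<in> Dsub_gens n i" "eps n j (i + 1) \<in> Dsub_gens n i"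
  using assms by (auto simp: Dsub_gens_def)

lemma eps_upto_Suc: "eps_upto n (i + 1) = eps_upto n i \<union> Dsub_gens n i"
proof
  show "eps_upto n (i + 1) \<subseteq> eps_upto n i \<union> Dsub_gens n i"
  proof
    fix \<phi> assume "\<phi> \<in> eps_upto n (i + 1)"
    then obtain a b where \<phi>: "\<phi> = eps n a b" "a \<in> {1..i+1}" "b \<in> {1..i+1}" "a \<noteq> b"
      by (auto simp: eps_upto_def)
    then consider "a \<in> {1..i}" "b \<in> {1..i}" | "a = i + 1" "b \<in> {1..i}" | "b = i + 1" "a \<in> {1..i}"
      by fastforce
    then show "\<phi> \<in> eps_upto n i \<union> Dsub_gens n i"
      using \<phi> by cases (auto simp: eps_upto_def eps_in_Dsub_gens)
  qed
  show "eps_upto n i \<union> Dsub_gens n i \<subseteq> eps_upto n (i + 1)"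
    by (fastforce simp: eps_upto_def Dsub_gens_def)
qed

lemma generated_upto_Dsub:
  assumes "i + 1 \<le> n"
  shows "generated_upto (Cb n) (Dsub n) i = generate (Cb n) (eps_upto n (i + 1))"
proof -
  interpret C: group "Cb n" by (rule group_Cb)
  have "eps_upto n (i + 1) = (\<Union>k\<in>{1..i}. Dsub_gens n k)" for i
  proof (induction i)
    case 0
    show ?case by (auto simp: eps_upto_def)
  next
    case (Suc i)
    then show ?case
      using eps_upto_Suc[of n "Suc i"] unfolding Suc_eq_plus1[symmetric]
      by (simp add: atLeastAtMostSuc_conv Un_commute)
  qed
  note E = this
  have sub: "eps_upto n (i + 1) \<subseteq> carrier (Cb n)"
    using assms by (rule eps_upto_subset)
  show ?thesis
  proof
    have "(\<Union>k\<in>{1..i}. Dsub n k) \<subseteq> generate (Cb n) (eps_upto n (i + 1))"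
      unfolding E Dsub_eq_generate by (intro UN_least C.mono_generate) auto
    then show "generated_upto (Cb n) (Dsub n) i \<subseteq> generate (Cb n) (eps_upto n (i + 1))"
      unfolding generated_upto_def by (rule C.generate_subgroup_incl) (rule C.generate_is_subgroup[OF sub])
    show "generate (Cb n) (eps_upto n (i + 1)) \<subseteq> generated_upto (Cb n) (Dsub n) i"
      unfolding generated_upto_def E Dsub_eq_generate
      by (intro C.mono_generate UN_mono) (auto intro: generate.incl)
  qed
qed

text \<open>
  Write \<open>m = i + 1\<close> and \<open>s = \<epsilon>\<^sub>j\<^sub>k\<close>. Most generators commute with \<open>s\<close>. Both \<open>\<epsilon>\<^sub>m\<^sub>j\<close> and \<open>\<epsilon>\<^sub>j\<^sub>m\<close> commute
  with the product of \<open>s\<close> and \<open>\<epsilon>\<^sub>m\<^sub>k\<close>, so \<open>s\<close> acts on them as the inverse of \<open>\<epsilon>\<^sub>m\<^sub>k\<close> does, which lies in the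
  subgroup; \<open>\<epsilon>\<^sub>k\<^sub>m\<close> follows since \<open>s\<close> commutes with the product of \<open>\<epsilon>\<^sub>j\<^sub>m\<close> and \<open>\<epsilon>\<^sub>k\<^sub>m\<close>.
\<close>

lemma eps_conj_Dsub_gens:
  assumes i: "i + 1 \<le> n" and s: "s \<in> eps_upto n i" and t: "t \<in> Dsub_gens n i"
  shows "s \<otimes>\<^bsub>Cb n\<^esub> t \<otimes>\<^bsub>Cb n\<^esub> inv\<^bsub>Cb n\<^esub> s \<in> generate (Cb n) (Dsub_gens n i) \<and>
         inv\<^bsub>Cb n\<^esub> s \<otimes>\<^bsub>Cb n\<^esub> t \<otimes>\<^bsub>Cb n\<^esub> s \<in> generate (Cb n) (Dsub_gens n i)"
proof -
  interpret C: group "Cb n" by (rule group_Cb)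
  let ?D = "generate (Cb n) (Dsub_gens n i)"
  define m where "m = i + 1"
  obtain j k where s_eq: "s = eps n j k" and jk: "j \<in> {1..i}" "k \<in> {1..i}" "j \<noteq> k"
    using s by (auto simp: eps_upto_def)
  have r: "j \<in> {1..n}" "k \<in> {1..n}" "m \<in> {1..n}" "j \<noteq> m" "k \<noteq> m"
    using jk i by (auto simp: m_def)
  have D: "eps n m l \<in> ?D" "inv\<^bsub>Cb n\<^esub> eps n m l \<in> ?D" "eps n l m \<in> ?D" "inv\<^bsub>Cb n\<^esub> eps n l m \<in> ?D"
    if "l \<in> {1..i}" for l
    using that by (auto simp: m_def eps_in_Dsub_gens intro: generate.incl generate.inv)
  have s: "s \<in> carrier (Cb n)" using r by (simp add: s_eq)
  have commute: "s \<otimes>\<^bsub>Cb n\<^esub> x \<otimes>\<^bsub>Cb n\<^esub> inv\<^bsub>Cb n\<^esub> s \<in> ?D \<and> inv\<^bsub>Cb n\<^esub> s \<otimes>\<^bsub>Cb n\<^esub> x \<otimes>\<^bsub>Cb n\<^esub> s \<in> ?D"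
    if "s \<otimes>\<^bsub>Cb n\<^esub> x = x \<otimes>\<^bsub>Cb n\<^esub> s" "x \<in> ?D" "x \<in> carrier (Cb n)" for x
    using that C.commute_imp_conj_eq[OF that(1) s that(3)] by simp
  have via: "s \<otimes>\<^bsub>Cb n\<^esub> c \<otimes>\<^bsub>Cb n\<^esub> inv\<^bsub>Cb n\<^esub> s \<in> ?D \<and> inv\<^bsub>Cb n\<^esub> s \<otimes>\<^bsub>Cb n\<^esub> c \<otimes>\<^bsub>Cb n\<^esub> s \<in> ?D"
    if "s \<otimes>\<^bsub>Cb n\<^esub> eps n m k \<otimes>\<^bsub>Cb n\<^esub> c = c \<otimes>\<^bsub>Cb n\<^esub> (s \<otimes>\<^bsub>Cb n\<^esub> eps n m k)" "c \<in> ?D" "c \<in> carrier (Cb n)" for c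
  proof -
    have "s \<otimes>\<^bsub>Cb n\<^esub> eps n m k = eps n m k \<otimes>\<^bsub>Cb n\<^esub> s"
      using r by (simp add: s_eq eps_commute_same[of j])
    then show ?thesis
      using C.conj_eq_conj_by_partner[of s "eps n m k" c] that s r jk D(1,2)[of k] by (simp add: generate.eng)
  qed
  have mj: "s \<otimes>\<^bsub>Cb n\<^esub> eps n m j \<otimes>\<^bsub>Cb n\<^esub> inv\<^bsub>Cb n\<^esub> s \<in> ?D \<and> inv\<^bsub>Cb n\<^esub> s \<otimes>\<^bsub>Cb n\<^esub> eps n m j \<otimes>\<^bsub>Cb n\<^esub> s \<in> ?D"
    using eps_McCool[of m n k j] eps_commute_same[of j n m k] r jk D
    by (intro via) (auto simp: s_eq)
  have jm: "s \<otimes>\<^bsub>Cb n\<^esub> eps n j m \<otimes>\<^bsub>Cb n\<^esub> inv\<^bsub>Cb n\<^esub> s \<in> ?D \<and> inv\<^bsub>Cb n\<^esub> s \<otimes>\<^bsub>Cb n\<^esub> eps n j m \<otimes>\<^bsub>Cb n\<^esub> s \<in> ?D"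
    using eps_McCool[of j n k m] r jk D by (intro via) (auto simp: s_eq)
  have km: "s \<otimes>\<^bsub>Cb n\<^esub> eps n k m \<otimes>\<^bsub>Cb n\<^esub> inv\<^bsub>Cb n\<^esub> s \<in> ?D \<and> inv\<^bsub>Cb n\<^esub> s \<otimes>\<^bsub>Cb n\<^esub> eps n k m \<otimes>\<^bsub>Cb n\<^esub> s \<in> ?D"
  proof -
    \<comment> \<open>\<open>s\<close> commutes with the product of \<open>\<epsilon>\<^sub>j\<^sub>m\<close> and \<open>\<epsilon>\<^sub>k\<^sub>m\<close>, and the first factor is settled.\<close>
    let ?x = "eps n j m" and ?y = "eps n k m"
    have x: "?x \<in> carrier (Cb n)" and y: "?y \<in> carrier (Cb n)"
      using r by simp_all
    have xy: "s \<otimes>\<^bsub>Cb n\<^esub> (?x \<otimes>\<^bsub>Cb n\<^esub> ?y) \<otimes>\<^bsub>Cb n\<^esub> inv\<^bsub>Cb n\<^esub> s = ?x \<otimes>\<^bsub>Cb n\<^esub> ?y"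
      "inv\<^bsub>Cb n\<^esub> s \<otimes>\<^bsub>Cb n\<^esub> (?x \<otimes>\<^bsub>Cb n\<^esub> ?y) \<otimes>\<^bsub>Cb n\<^esub> s = ?x \<otimes>\<^bsub>Cb n\<^esub> ?y"
      using C.commute_imp_conj_eq[of s "?x \<otimes>\<^bsub>Cb n\<^esub> ?y"] eps_McCool[of j n m k] r jk s x y by (simp_all add: s_eq)
    have "s \<otimes>\<^bsub>Cb n\<^esub> ?y \<otimes>\<^bsub>Cb n\<^esub> inv\<^bsub>Cb n\<^esub> s =
        inv\<^bsub>Cb n\<^esub> (s \<otimes>\<^bsub>Cb n\<^esub> ?x \<otimes>\<^bsub>Cb n\<^esub> inv\<^bsub>Cb n\<^esub> s) \<otimes>\<^bsub>Cb n\<^esub> (s \<otimes>\<^bsub>Cb n\<^esub> (?x \<otimes>\<^bsub>Cb n\<^esub> ?y) \<otimes>\<^bsub>Cb n\<^esub> inv\<^bsub>Cb n\<^esub> s)"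
      "inv\<^bsub>Cb n\<^esub> s \<otimes>\<^bsub>Cb n\<^esub> ?y \<otimes>\<^bsub>Cb n\<^esub> s =
        inv\<^bsub>Cb n\<^esub> (inv\<^bsub>Cb n\<^esub> s \<otimes>\<^bsub>Cb n\<^esub> ?x \<otimes>\<^bsub>Cb n\<^esub> s) \<otimes>\<^bsub>Cb n\<^esub> (inv\<^bsub>Cb n\<^esub> s \<otimes>\<^bsub>Cb n\<^esub> (?x \<otimes>\<^bsub>Cb n\<^esub> ?y) \<otimes>\<^bsub>Cb n\<^esub> s)"
      using s x y by (simp_all add: C.m_assoc C.inv_mult_group C.inv_cancel_left)
    moreover have "?x \<otimes>\<^bsub>Cb n\<^esub> ?y \<in> ?D"
      using jk D by (intro generate.eng) auto
    ultimately show ?thesis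
      using C.generate_m_inv_closed[OF Dsub_gens_subset[OF i]] jm unfolding xy by (auto intro: generate.eng)
  qed
  from t obtain l where l: "l \<in> {1..i}" and t_eq: "t = eps n m l \<or> t = eps n l m"
    by (auto simp: Dsub_gens_def m_def)
  have l': "l \<in> {1..n}" "l \<noteq> m" using l i by (auto simp: m_def)
  from t_eq show ?thesis
  proof
    assume t: "t = eps n m l"
    show ?thesis
    proof (cases "l = j")
      case False
      then show ?thesis
        using eps_commute_disjoint[of j n k m l] r l' D(1)[OF l] unfolding t
        by (intro commute) (auto simp: s_eq)
    qed (use mj t in simp)
  next
    assume t: "t = eps n l m"
    consider "l = j" | "l = k" | "l \<noteq> j" "l \<noteq> k" by blast
    then show ?thesis
    proof cases
      case 3
      then show ?thesis
        using eps_commute_disjoint[of j n k l m] r l' D(3)[OF l] unfolding t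
        by (intro commute) (auto simp: s_eq)
    qed (use jm km t in simp_all)
  qed
qed

text \<open>
  The retraction that forgets the strand \<open>m\<close>; it separates the two factors of the semidirect product.
\<close>

definition kill :: "nat \<Rightarrow> nat \<Rightarrow> nat word \<Rightarrow> nat word" where
  "kill n m = endo n (\<lambda>l. if l = m then \<one>\<^bsub>Fn n\<^esub> else xg l)"

lemma kill_hom: "kill n m \<in> hom (Fn n) (Fn n)"
proof -
  interpret F: group "Fn n" by (rule group_free_group)
  show ?thesis unfolding kill_def by (rule endo_hom) simp
qed

lemma kill_gen: "l \<in> {1..n} \<Longrightarrow> kill n m (xg l) = (if l = m then \<one>\<^bsub>Fn n\<^esub> else xg l)"
proof -
  interpret F: group "Fn n" by (rule group_free_group)
  show "l \<in> {1..n} \<Longrightarrow> ?thesis" unfolding kill_def by (subst endo_gen) auto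
qed

text \<open>
  Each generator of \<open>Dsub n i\<close> either conjugates \<open>x\<^sub>m\<close> or conjugates by \<open>x\<^sub>m\<close>, where \<open>m = i + 1\<close>; neither is
  visible after \<open>x\<^sub>m\<close> has been killed.
\<close>

lemma kill_Dsub:
  assumes i: "i + 1 \<le> n" and "\<phi> \<in> Dsub n i" "x \<in> carrier (Fn n)"
  shows "kill n (i + 1) (\<phi> x) = kill n (i + 1) x"
proof -
  interpret C: group "Cb n" by (rule group_Cb)
  interpret F: group "Fn n" by (rule group_free_group)
  let ?\<pi> = "kill n (i + 1)"
  interpret \<pi>: group_hom "Fn n" "Fn n" ?\<pi> by unfold_locales (rule kill_hom)
  let ?K = "{\<phi> \<in> carrier (Cb n). \<forall>x\<in>carrier (Fn n). ?\<pi> (\<phi> x) = ?\<pi> x}"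
  have "subgroup ?K (Cb n)"
  proof (rule C.subgroupI)
    have "\<one>\<^bsub>Cb n\<^esub> \<in> ?K" by (simp add: Cb_one_apply)
    then show "?K \<noteq> {}" by blast
  next
    fix \<phi> assume \<phi>: "\<phi> \<in> ?K"
    have "?\<pi> ((inv\<^bsub>Cb n\<^esub> \<phi>) x) = ?\<pi> x" if x: "x \<in> carrier (Fn n)" for x
    proof -
      have "(inv\<^bsub>Cb n\<^esub> \<phi>) x \<in> carrier (Fn n)"
        using \<phi> x by (simp add: Cb_closed)
      then have "?\<pi> (\<phi> ((inv\<^bsub>Cb n\<^esub> \<phi>) x)) = ?\<pi> ((inv\<^bsub>Cb n\<^esub> \<phi>) x)"
        using \<phi> by blast
      then show ?thesis
        using \<phi> x by (simp add: Cb_inv_apply)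
    qed
    then show "inv\<^bsub>Cb n\<^esub> \<phi> \<in> ?K" using \<phi> by simp
  qed (auto simp: Cb_apply Cb_closed)
  moreover have "Dsub_gens n i \<subseteq> ?K"
  proof
    fix \<phi> assume "\<phi> \<in> Dsub_gens n i"
    then obtain j where j: "j \<in> {1..i}" and \<phi>_eq: "\<phi> = eps n (i + 1) j \<or> \<phi> = eps n j (i + 1)"
      by (auto simp: Dsub_gens_def)
    then have \<phi>: "\<phi> \<in> carrier (Cb n)" using i by auto
    have gen: "(?\<pi> \<circ> \<phi>) (xg l) = ?\<pi> (xg l)" if "l \<in> {1..n}" for l
      using \<phi>_eq j i that by (auto simp: eps_gen kill_gen)
    have "(?\<pi> \<circ> \<phi>) x = ?\<pi> x" if "x \<in> carrier (Fn n)" for x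
      by (rule free_group_hom_eq[OF group_free_group hom_compose[OF Cb_hom[OF \<phi>] kill_hom] kill_hom gen that])
    then show "\<phi> \<in> ?K" using \<phi> by simp
  qed
  ultimately have "Dsub n i \<subseteq> ?K"
    unfolding Dsub_eq_generate by (rule C.generate_subgroup_incl[rotated])
  then show ?thesis using assms by blast
qed

text \<open>
  The generators \<open>eps n a b\<close> with \<open>a, b < m\<close> do not involve \<open>x\<^sub>m\<close>, and commuting with a given map passes to
  products and inverses.
\<close>

lemma eps_upto_kill:
  assumes m: "m \<in> {1..n}" and i: "i < m" and \<phi>: "\<phi> \<in> generate (Cb n) (eps_upto n i)"
  shows "\<phi> (xg m) = xg m" "x \<in> carrier (Fn n) \<Longrightarrow> kill n m (\<phi> x) = \<phi> (kill n m x)"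
proof -
  interpret C: group "Cb n" by (rule group_Cb)
  interpret F: group "Fn n" by (rule group_free_group)
  let ?\<pi> = "kill n m"
  interpret \<pi>: group_hom "Fn n" "Fn n" ?\<pi> by unfold_locales (rule kill_hom)
  let ?K = "{\<phi> \<in> carrier (Cb n). \<phi> (xg m) = xg m \<and> (\<forall>x\<in>carrier (Fn n). ?\<pi> (\<phi> x) = \<phi> (?\<pi> x))}"
  have "subgroup ?K (Cb n)"
  proof (rule C.subgroupI)
    have "\<one>\<^bsub>Cb n\<^esub> \<in> ?K" using m by (simp add: Cb_one_apply)
    then show "?K \<noteq> {}" by blast
  next
    fix \<phi> assume \<phi>: "\<phi> \<in> ?K"
    then have c: "\<phi> \<in> carrier (Cb n)" "inv\<^bsub>Cb n\<^esub> \<phi> \<in> carrier (Cb n)" by simp_all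
    have "(inv\<^bsub>Cb n\<^esub> \<phi>) (\<phi> (xg m)) = xg m"
      using c m by (simp add: Cb_inv_apply)
    then have "(inv\<^bsub>Cb n\<^esub> \<phi>) (xg m) = xg m"
      using \<phi> by simp
    moreover have "?\<pi> ((inv\<^bsub>Cb n\<^esub> \<phi>) x) = (inv\<^bsub>Cb n\<^esub> \<phi>) (?\<pi> x)" if x: "x \<in> carrier (Fn n)" for x
    proof -
      have y: "(inv\<^bsub>Cb n\<^esub> \<phi>) x \<in> carrier (Fn n)"
        using c x by (simp add: Cb_closed)
      then have "?\<pi> (\<phi> ((inv\<^bsub>Cb n\<^esub> \<phi>) x)) = \<phi> (?\<pi> ((inv\<^bsub>Cb n\<^esub> \<phi>) x))"
        using \<phi> by blast
      then have "?\<pi> x = \<phi> (?\<pi> ((inv\<^bsub>Cb n\<^esub> \<phi>) x))"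
        using c x by (simp add: Cb_inv_apply)
      then show ?thesis
        using c y by (simp add: Cb_inv_apply)
    qed
    ultimately show "inv\<^bsub>Cb n\<^esub> \<phi> \<in> ?K" using c by simp
  qed (use m in \<open>auto simp: Cb_apply Cb_closed\<close>)
  moreover have "eps_upto n i \<subseteq> ?K"
  proof
    fix \<phi> assume "\<phi> \<in> eps_upto n i"
    then obtain a b where ab: "a \<in> {1..i}" "b \<in> {1..i}" and \<phi>_eq: "\<phi> = eps n a b"
      by (auto simp: eps_upto_def)
    then have \<phi>: "\<phi> \<in> carrier (Cb n)" using i m by auto
    interpret \<phi>: group_hom "Fn n" "Fn n" \<phi> by unfold_locales (rule Cb_hom[OF \<phi>])
    have gen: "(?\<pi> \<circ> \<phi>) (xg l) = (\<phi> \<circ> ?\<pi>) (xg l)" if "l \<in> {1..n}" for l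
      using ab i m that \<phi>.hom_one by (auto simp: \<phi>_eq eps_gen kill_gen)
    have "(?\<pi> \<circ> \<phi>) x = (\<phi> \<circ> ?\<pi>) x" if "x \<in> carrier (Fn n)" for x
      by (rule free_group_hom_eq[OF group_free_group hom_compose[OF Cb_hom[OF \<phi>] kill_hom]
            hom_compose[OF kill_hom Cb_hom[OF \<phi>]] gen that])
    moreover have "\<phi> (xg m) = xg m"
      using ab i m by (simp add: \<phi>_eq eps_gen)
    ultimately show "\<phi> \<in> ?K" using \<phi> by simp
  qed
  ultimately have "generate (Cb n) (eps_upto n i) \<subseteq> ?K"
    by (rule C.generate_subgroup_incl[rotated])
  then show "\<phi> (xg m) = xg m" "x \<in> carrier (Fn n) \<Longrightarrow> kill n m (\<phi> x) = \<phi> (kill n m x)"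
    using \<phi> by blast+
qed

text \<open>
  An element of both factors commutes with killing \<open>x\<^bsub>i+1\<^esub>\<close> and is invisible to it. Hence it fixes every
  other generator, and \<open>x\<^bsub>i+1\<^esub>\<close> is fixed by the second factor.
\<close>

lemma Dsub_semidirect:
  assumes i: "i + 1 \<le> n"
  shows "is_semidirect (Cb n\<lparr>carrier := generate (Cb n) (eps_upto n (i + 1))\<rparr>) (Dsub n i)
    (generate (Cb n) (eps_upto n i))"
proof -
  interpret C: group "Cb n" by (rule group_Cb)
  have "\<phi> = \<one>\<^bsub>Cb n\<^esub>"
    if \<phi>: "\<phi> \<in> generate (Cb n) (Dsub_gens n i)" "\<phi> \<in> generate (Cb n) (eps_upto n i)" for \<phi>
  proof (rule Cb_eqI)
    have m: "i + 1 \<in> {1..n}" using i by simp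
    show "\<phi> \<in> carrier (Cb n)" "\<one>\<^bsub>Cb n\<^esub> \<in> carrier (Cb n)"
      using C.generate_incl[OF Dsub_gens_subset[OF i]] \<phi> by auto
    fix l assume l: "l \<in> {1..n}"
    have "\<phi> (xg l) = xg l"
      \<comment> \<open>For \<open>l \<noteq> i + 1\<close>: \<open>\<phi> x\<^sub>l = \<phi> (kill x\<^sub>l) = kill (\<phi> x\<^sub>l) = kill x\<^sub>l = x\<^sub>l\<close>.\<close>
    proof (cases "l = i + 1")
      case True
      then show ?thesis using eps_upto_kill(1)[OF m _ \<phi>(2)] by simp
    next
      case False
      have "\<phi> (kill n (i + 1) (xg l)) = kill n (i + 1) (\<phi> (xg l))"
        using eps_upto_kill(2)[OF m _ \<phi>(2), of "xg l"] l by simp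
      also have "\<dots> = kill n (i + 1) (xg l)"
        using kill_Dsub[OF i, of \<phi> "xg l"] \<phi>(1) l by (simp add: Dsub_eq_generate)
      finally show ?thesis using False l by (simp add: kill_gen)
    qed
    then show "\<phi> (xg l) = \<one>\<^bsub>Cb n\<^esub> (xg l)" using l by (simp add: Cb_one_apply)
  qed
  then show ?thesis
    unfolding eps_upto_Suc Dsub_eq_generate
    using i eps_conj_Dsub_gens[OF i] eps_upto_subset[of i n] Dsub_gens_subset[OF i]
    by (intro C.is_semidirect_generateI) auto
qed


section \<open>Free and free abelian subgroups\<close>

text \<open>
  The product of the \<open>eps n m j\<close> along a word \<open>u\<close> conjugates \<open>x\<^sub>m\<close> by \<open>u\<close> read backwards. If it is trivial, this
  word commutes with \<open>x\<^sub>m\<close> although \<open>x\<^sub>m\<close> does not occur in it, which forces \<open>u\<close> to be empty.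
\<close>

lemma eps_free:
  assumes m: "m \<in> {1..n}" and i: "i < m"
  shows "freely_generates (Cb n) {1..i} (\<lambda>j. eps n m j)"
proof (rule freely_generatesI[OF group_Cb])
  interpret C: group "Cb n" by (rule group_Cb)
  interpret F: group "Fn n" by (rule group_free_group)
  have e: "eps n m a \<in> carrier (Cb n)" if "a \<in> {1..i}" for a
    using that m i by simp
  then show "(\<lambda>j. eps n m j) \<in> {1..i} \<rightarrow> carrier (Cb n)" by blast
  let ?h = "free_lift (Cb n) (\<lambda>j. eps n m j)"
  have F: "w \<in> carrier (Fn n)" if "w \<in> carrier (free_group {1..i})" for w
    using that m i by (fastforce simp: free_group_carrier)
  \<comment> \<open>In \<open>e\<^sub>l \<otimes> \<phi>\<^sub>u\<close> the letter \<open>l\<close> acts first, so it becomes the last letter of the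
    conjugator; this is why \<open>u\<close> appears reversed.\<close>
  have main: "?h u \<in> carrier (Cb n) \<and>
      ?h u (xg m) = inv\<^bsub>Fn n\<^esub> rev u \<otimes>\<^bsub>Fn n\<^esub> xg m \<otimes>\<^bsub>Fn n\<^esub> rev u \<and> (\<forall>a\<in>{1..i}. ?h u (xg a) = xg a)"
    if "u \<in> carrier (free_group {1..i})" for u
    using that
  proof (induction u)
    case Nil
    have "inv\<^bsub>Fn n\<^esub> [] \<otimes>\<^bsub>Fn n\<^esub> xg m \<otimes>\<^bsub>Fn n\<^esub> [] = xg m"
      using m F.l_one[of "xg m"] F.r_one[of "xg m"] F.inv_one unfolding free_group_one by simp
    then show ?case using m i by (simp add: free_lift_def Cb_one_apply)
  next
    case (Cons l u)
    obtain a b where l: "l = (a, b)" by (cases l)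
    have a: "a \<in> {1..i}" "a \<in> {1..n}" "a \<noteq> m" and u: "u \<in> carrier (free_group {1..i})"
      using Cons.prems m i by (auto simp: l free_group_carrier reduced_Cons)
    have hu: "?h u \<in> carrier (Cb n)" "?h u (xg m) = inv\<^bsub>Fn n\<^esub> rev u \<otimes>\<^bsub>Fn n\<^esub> xg m \<otimes>\<^bsub>Fn n\<^esub> rev u"
      "\<And>a. a \<in> {1..i} \<Longrightarrow> ?h u (xg a) = xg a"
      using Cons.IH[OF u] by blast+
    define e where "e = (if b then eps n m a else inv\<^bsub>Cb n\<^esub> eps n m a)"
    define y where "y = (if b then xg a else inv\<^bsub>Fn n\<^esub> xg a)"
    have ec: "e \<in> carrier (Cb n)" and y: "y \<in> carrier (Fn n)"
      using a m by (simp_all add: e_def y_def)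
    have h: "?h (l # u) = e \<otimes>\<^bsub>Cb n\<^esub> ?h u"
      by (simp add: free_lift_def l e_def)
    have em: "e (xg m) = inv\<^bsub>Fn n\<^esub> y \<otimes>\<^bsub>Fn n\<^esub> xg m \<otimes>\<^bsub>Fn n\<^esub> y"
      using a m by (simp add: e_def y_def eps_gen inv_eps_gen)
    have el: "e (xg c) = xg c" if "c \<in> {1..i}" for c
      using a m i that by (simp add: e_def eps_gen inv_eps_gen)
    have hy: "?h u y = y"
      using a by (simp add: y_def Cb_hom_simps[OF hu(1)] hu(3))
    have ru: "rev u \<in> carrier (Fn n)"
      using F[OF u] by (simp add: free_group_carrier reduced_rev)
    have "reduced (rev u @ [(a, b)])"
      using Cons.prems reduced_rev[of "l # u"] by (simp add: l free_group_carrier)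
    moreover have "y = [(a, b)]"
      using a by (simp add: y_def free_group_inv_gen) (simp add: free_gen_def)
    ultimately have rev: "rev (l # u) = rev u \<otimes>\<^bsub>Fn n\<^esub> y"
      by (simp add: l free_group_mult_append)
    have "(e \<otimes>\<^bsub>Cb n\<^esub> ?h u) (xg m) = ?h u (inv\<^bsub>Fn n\<^esub> y \<otimes>\<^bsub>Fn n\<^esub> xg m \<otimes>\<^bsub>Fn n\<^esub> y)"
      using ec hu(1) m by (simp add: Cb_apply em)
    also have "\<dots> = inv\<^bsub>Fn n\<^esub> y \<otimes>\<^bsub>Fn n\<^esub> ?h u (xg m) \<otimes>\<^bsub>Fn n\<^esub> y"
      using y m by (simp add: Cb_hom_simps[OF hu(1)] hy)
    also have "\<dots> = inv\<^bsub>Fn n\<^esub> rev (l # u) \<otimes>\<^bsub>Fn n\<^esub> xg m \<otimes>\<^bsub>Fn n\<^esub> rev (l # u)"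
      unfolding rev using y m ru by (simp add: hu(2) F.m_assoc F.inv_mult_group)
    finally show ?case
      unfolding h using ec hu el m i by (auto simp: Cb_apply)
  qed
  show "u = []" if u: "u \<in> carrier (free_group {1..i})" "?h u = \<one>\<^bsub>Cb n\<^esub>" for u
  proof (rule ccontr)
    assume "u \<noteq> []"
    then obtain c d v where v: "rev u = (c, d) # v"
      by (cases "rev u") auto
    have c: "set (rev u) \<subseteq> {1..i} \<times> UNIV" "reduced (rev u)"
      using u(1) by (auto simp: free_group_carrier reduced_rev)
    then have r: "rev u \<in> carrier (Fn n)"
      using F[of "rev u"] by (simp add: free_group_carrier)
    have "inv\<^bsub>Fn n\<^esub> rev u \<otimes>\<^bsub>Fn n\<^esub> xg m \<otimes>\<^bsub>Fn n\<^esub> rev u = xg m"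
      using main[OF u(1)] m by (simp add: u(2) Cb_one_apply)
    then have "rev u \<otimes>\<^bsub>Fn n\<^esub> (inv\<^bsub>Fn n\<^esub> rev u \<otimes>\<^bsub>Fn n\<^esub> xg m \<otimes>\<^bsub>Fn n\<^esub> rev u) = rev u \<otimes>\<^bsub>Fn n\<^esub> xg m"
      by simp
    then have "xg m \<otimes>\<^bsub>Fn n\<^esub> rev u = rev u \<otimes>\<^bsub>Fn n\<^esub> xg m"
      using r m by (simp add: F.m_assoc F.inv_cancel_left)
    moreover have "hd (rev u) \<in> {1..i} \<times> UNIV" "last (rev u) \<in> {1..i} \<times> UNIV"
      using c(1) hd_in_set[of "rev u"] last_in_set[of "rev u"] \<open>u \<noteq> []\<close> by auto
    then have "fst (hd (rev u)) \<noteq> m" "fst (last (rev u)) \<noteq> m"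
      using i by (auto simp: mem_Times_iff)
    then have "reduced (xg m @ rev u)" "reduced (rev u @ xg m)"
      using c(2) by (simp_all add: reduced_append free_gen_def reduced_Cons cancels_def)
    ultimately have "xg m @ rev u = rev u @ xg m"
      by (simp add: free_group_mult_append)
    then show False
      using v c(1) i by (simp add: free_gen_def)
  qed
qed

text \<open>
  The isomorphism sends \<open>c\<close> to the automorphism with exponents \<open>c\<close>. These exponents can be read off from the
  images of the generators, because a nontrivial power of \<open>x\<^sub>m\<close> does not commute with \<open>x\<^sub>l\<close>.
\<close>

lemma eps_free_abelian:
  assumes m: "m \<in> {1..n}" and i: "i < m"
  shows "freely_abelian_generates (Cb n) {1..i} (\<lambda>j. eps n j m)"
proof (rule freely_abelian_generatesI[OF group_Cb, where h = "\<lambda>c. conj_pow n m (Poly_Mapping.lookup c)"])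
  interpret F: group "Fn n" by (rule group_free_group)
  show "(\<lambda>c. conj_pow n m (Poly_Mapping.lookup c)) \<in> hom (free_Abelian_group {1..i}) (Cb n)"
    using m by (auto simp: hom_def conj_pow_Cb conj_pow_mult plus_poly_mapping.rep_eq)
  show "conj_pow n m (Poly_Mapping.lookup (frag_of a)) = eps n a m" if "a \<in> {1..i}" for a
  proof -
    have "Poly_Mapping.lookup (frag_of a) = (\<lambda>l. of_bool (l = a))"
      by (auto simp: lookup_single when_def)
    then show ?thesis
      using that m i by (simp add: eps_conj_pow)
  qed
  show "c = 0" if c: "Poly_Mapping.keys c \<subseteq> {1..i}" "conj_pow n m (Poly_Mapping.lookup c) = \<one>\<^bsub>Cb n\<^esub>" for c
  proof (rule poly_mapping_eqI)
    fix l
    show "Poly_Mapping.lookup c l = Poly_Mapping.lookup 0 l"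
    proof (cases "l \<in> {1..i}")
      case True
      then have l: "l \<in> {1..n}" "l \<noteq> m" using m i by auto
      define p where "p = xg m [^]\<^bsub>Fn n\<^esub> Poly_Mapping.lookup c l"
      have p: "p \<in> carrier (Fn n)" using m by (simp add: p_def)
      have "inv\<^bsub>Fn n\<^esub> p \<otimes>\<^bsub>Fn n\<^esub> xg l \<otimes>\<^bsub>Fn n\<^esub> p = xg l"
        using conj_pow_gen[OF m l(1), of "Poly_Mapping.lookup c"] l by (simp add: c(2) p_def Cb_one_apply)
      then have "p \<otimes>\<^bsub>Fn n\<^esub> (inv\<^bsub>Fn n\<^esub> p \<otimes>\<^bsub>Fn n\<^esub> xg l \<otimes>\<^bsub>Fn n\<^esub> p) = p \<otimes>\<^bsub>Fn n\<^esub> xg l"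
        by simp
      then have "p \<otimes>\<^bsub>Fn n\<^esub> xg l = xg l \<otimes>\<^bsub>Fn n\<^esub> p"
        using p l by (simp add: F.m_assoc F.inv_cancel_left)
      then show ?thesis
        using xg_int_pow_commute[OF m l(1) l(2)] by (simp add: p_def)
    next
      case False
      then show ?thesis using c(1) by (auto simp: in_keys_iff)
    qed
  qed
qed


section \<open>Pure braids\<close>

lemma conj_pow_indicator:
  assumes m: "i + 1 \<le> n" and A: "A \<subseteq> {1..i}"
  shows "conj_pow n (i + 1) (\<lambda>l. of_bool (l \<in> A)) \<in> generate (Cb n) (Dsub_gens n i)"
proof -
  have m': "i + 1 \<in> {1..n}" using m by simp
  have "finite A" using A by (rule finite_subset) simp
  then show ?thesis using A
  proof (induction A)
    case empty
    then show ?case using conj_pow_one[OF m'] by (simp add: generate.one)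
  next
    case (insert a A)
    have "conj_pow n (i + 1) (\<lambda>l. of_bool (l \<in> insert a A)) =
        eps n a (i + 1) \<otimes>\<^bsub>Cb n\<^esub> conj_pow n (i + 1) (\<lambda>l. of_bool (l \<in> A))"
      using insert m m' by (subst eps_conj_pow) (auto simp: conj_pow_mult intro!: conj_pow_cong)
    moreover have "eps n a (i + 1) \<in> generate (Cb n) (Dsub_gens n i)"
      using insert by (auto intro!: generate.incl eps_in_Dsub_gens)
    ultimately show ?case
      using insert by (simp add: generate.eng)
  qed
qed

text \<open>
  With \<open>s = i + 1\<close>, the braid generator factors as \<open>B\<inverse> \<epsilon>\<^sub>r\<^sub>s\<inverse> \<epsilon>\<^sub>s\<^sub>r\<inverse> B\<close>, where \<open>B\<close> is the product of all \<open>\<epsilon>\<^sub>l\<^sub>s\<close>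
  with \<open>r < l < s\<close>.
\<close>

lemma braid_a_in_Dsub:
  assumes r: "1 \<le> r" "r \<le> i" and i: "i + 1 \<le> n"
  shows "braid_a n r (i + 1) \<in> Dsub n i"
proof -
  interpret C: group "Cb n" by (rule group_Cb)
  interpret F: group "Fn n" by (rule group_free_group)
  define s where "s = i + 1"
  have rs: "r \<in> {1..n}" "s \<in> {1..n}" "r \<noteq> s" "r < s" using r i by (auto simp: s_def)
  \<comment> \<open>\<open>A\<close> acts on \<open>x\<^sub>r\<close> and \<open>x\<^sub>s\<close> as the braid generator does and fixes the strands between them.
    \<open>B\<close> conjugates those strands by \<open>x\<^sub>s\<close>, so that \<open>B\<inverse> A B\<close> conjugates them by
    \<open>x\<^sub>s A(x\<^sub>s)\<inverse>\<close>, which is the inverse of the commutator.\<close>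
  define c :: "nat \<Rightarrow> int" where "c = (\<lambda>l. of_bool (l \<in> {r<..i}))"
  define B where "B = conj_pow n s c"
  define A where "A = inv\<^bsub>Cb n\<^esub> eps n r s \<otimes>\<^bsub>Cb n\<^esub> inv\<^bsub>Cb n\<^esub> eps n s r"
  have B: "B \<in> generate (Cb n) (Dsub_gens n i)"
    unfolding B_def s_def c_def by (rule conj_pow_indicator[OF i]) (use r in auto)
  have "inv\<^bsub>Cb n\<^esub> eps n r s \<in> generate (Cb n) (Dsub_gens n i)" "inv\<^bsub>Cb n\<^esub> eps n s r \<in> generate (Cb n) (Dsub_gens n i)"
    using r unfolding s_def by (auto intro: generate.inv eps_in_Dsub_gens)
  then have prod: "inv\<^bsub>Cb n\<^esub> B \<otimes>\<^bsub>Cb n\<^esub> (A \<otimes>\<^bsub>Cb n\<^esub> B) \<in> generate (Cb n) (Dsub_gens n i)"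
    unfolding A_def using B C.generate_m_inv_closed[OF Dsub_gens_subset[OF i]] by (intro generate.eng) auto
  have car: "B \<in> carrier (Cb n)" "A \<in> carrier (Cb n)" "inv\<^bsub>Cb n\<^esub> B \<in> carrier (Cb n)"
    "eps n r s \<in> carrier (Cb n)" "eps n s r \<in> carrier (Cb n)"
    "inv\<^bsub>Cb n\<^esub> eps n r s \<in> carrier (Cb n)" "inv\<^bsub>Cb n\<^esub> eps n s r \<in> carrier (Cb n)"
    using rs by (simp_all add: B_def A_def conj_pow_Cb)
  have x: "xg r \<in> carrier (Fn n)" "xg s \<in> carrier (Fn n)" using rs by simp_all
  have B_gen: "B (xg l) = (if r < l \<and> l < s then inv\<^bsub>Fn n\<^esub> xg s \<otimes>\<^bsub>Fn n\<^esub> xg l \<otimes>\<^bsub>Fn n\<^esub> xg s else xg l)"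
    and B_inv: "(inv\<^bsub>Cb n\<^esub> B) (xg l) = (if r < l \<and> l < s then xg s \<otimes>\<^bsub>Fn n\<^esub> xg l \<otimes>\<^bsub>Fn n\<^esub> inv\<^bsub>Fn n\<^esub> xg s else xg l)"
    if "l \<in> {1..n}" for l
    using that rs by (auto simp: B_def c_def s_def conj_pow_inv conj_pow_gen F.int_pow_neg)
  have A_gen: "A (xg l) =
      (if l = r then xg r \<otimes>\<^bsub>Fn n\<^esub> xg s \<otimes>\<^bsub>Fn n\<^esub> xg r \<otimes>\<^bsub>Fn n\<^esub> inv\<^bsub>Fn n\<^esub> xg s \<otimes>\<^bsub>Fn n\<^esub> inv\<^bsub>Fn n\<^esub> xg r
       else if l = s then xg r \<otimes>\<^bsub>Fn n\<^esub> xg s \<otimes>\<^bsub>Fn n\<^esub> inv\<^bsub>Fn n\<^esub> xg r else xg l)" if "l \<in> {1..n}" for l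
    using that rs x car
    by (auto simp: A_def Cb_apply inv_eps_gen Cb_hom_simps F.m_assoc F.inv_mult_group F.inv_cancel_left)
  have "braid_a n r s = inv\<^bsub>Cb n\<^esub> B \<otimes>\<^bsub>Cb n\<^esub> (A \<otimes>\<^bsub>Cb n\<^esub> B)"
    unfolding braid_a_def
  proof (rule endo_eqI)
    show "inv\<^bsub>Cb n\<^esub> B \<otimes>\<^bsub>Cb n\<^esub> (A \<otimes>\<^bsub>Cb n\<^esub> B) \<in> carrier (Cb n)" using car by simp
    fix l assume l: "l \<in> {1..n}"
    have eq: "(inv\<^bsub>Cb n\<^esub> B \<otimes>\<^bsub>Cb n\<^esub> (A \<otimes>\<^bsub>Cb n\<^esub> B)) (xg l) = B (A ((inv\<^bsub>Cb n\<^esub> B) (xg l)))"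
      using car l by (simp add: Cb_apply Cb_closed)
    consider "s < l \<or> l < r" | "l = r" | "l = s" | "r < l" "l < s" by linarith
    then show "(if s < l \<or> l < r then xg l
      else if l = r then xg r \<otimes>\<^bsub>Fn n\<^esub> xg s \<otimes>\<^bsub>Fn n\<^esub> xg r \<otimes>\<^bsub>Fn n\<^esub> inv\<^bsub>Fn n\<^esub> xg s \<otimes>\<^bsub>Fn n\<^esub> inv\<^bsub>Fn n\<^esub> xg r
      else if l = s then xg r \<otimes>\<^bsub>Fn n\<^esub> xg s \<otimes>\<^bsub>Fn n\<^esub> inv\<^bsub>Fn n\<^esub> xg r
      else let c = commutator (Fn n) (inv\<^bsub>Fn n\<^esub> xg r) (inv\<^bsub>Fn n\<^esub> xg s)
        in c \<otimes>\<^bsub>Fn n\<^esub> xg l \<otimes>\<^bsub>Fn n\<^esub> inv\<^bsub>Fn n\<^esub> c) = (inv\<^bsub>Cb n\<^esub> B \<otimes>\<^bsub>Cb n\<^esub> (A \<otimes>\<^bsub>Cb n\<^esub> B)) (xg l)"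
      unfolding eq using l rs x
      by cases (auto simp: B_inv B_gen A_gen Cb_hom_simps[OF car(1)] Cb_hom_simps[OF car(2)]
          commutator_def Let_def F.m_assoc F.inv_mult_group F.inv_cancel_left)
  qed
  then show ?thesis using prod by (simp add: s_def Dsub_eq_generate)
qed


section \<open>The decomposition theorem\<close>

theorem theorem1p1:
  fixes n :: nat
  assumes "n \<ge> 2"
  shows "is_iterated_semidirect (Cb n) (Dsub n) (n - 1) \<and>
         (\<forall>i\<in>{1..n - 1}.
            freely_generates (Cb n) {1..i} (\<lambda>j. eps n (i + 1) j) \<and>
            freely_abelian_generates (Cb n) {1..i} (\<lambda>j. eps n j (i + 1))) \<and>
         (\<forall>i\<in>{1..n - 1}. subgroup (Usub n (i + 1)) ((Cb n)\<lparr>carrier := Dsub n i\<rparr>))"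
proof (intro conjI ballI)
  interpret C: group "Cb n" by (rule group_Cb)
  have D: "subgroup (Dsub n i) (Cb n)" if "i \<in> {1..n - 1}" for i
    unfolding Dsub_eq_generate using that assms by (intro C.generate_is_subgroup Dsub_gens_subset) auto
  have "generated_upto (Cb n) (Dsub n) (n - 1) = carrier (Cb n)"
    using assms generated_upto_Dsub[of "n - 1" n] Cb_generated_by_eps[of n] by simp
  moreover have "is_semidirect (Cb n\<lparr>carrier := generated_upto (Cb n) (Dsub n) i\<rparr>)
      (Dsub n i) (generated_upto (Cb n) (Dsub n) (i - 1))" if "i \<in> {2..n - 1}" for i
  proof -
    have "i + 1 \<le> n" "i - 1 + 1 = i" using that assms by auto
    then show ?thesis
      using generated_upto_Dsub[of i n] generated_upto_Dsub[of "i - 1" n] Dsub_semidirect[of i n] by simp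
  qed
  ultimately show "is_iterated_semidirect (Cb n) (Dsub n) (n - 1)"
    using D by (simp add: is_iterated_semidirect_def group_Cb)
next
  fix i assume i: "i \<in> {1..n - 1}"
  then show "freely_generates (Cb n) {1..i} (\<lambda>j. eps n (i + 1) j)"
    "freely_abelian_generates (Cb n) {1..i} (\<lambda>j. eps n j (i + 1))"
    using assms by (auto intro!: eps_free eps_free_abelian)
next
  fix i assume i: "i \<in> {1..n - 1}"
  interpret C: group "Cb n" by (rule group_Cb)
  have i': "i + 1 \<le> n" using i assms by auto
  have D: "subgroup (Dsub n i) (Cb n)"
    unfolding Dsub_eq_generate by (rule C.generate_is_subgroup[OF Dsub_gens_subset[OF i']])
  have "(\<lambda>r. braid_a n r (i + 1)) ` {1..<i + 1} \<subseteq> Dsub n i"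
    using braid_a_in_Dsub[OF _ _ i'] by auto
  then have "Usub n (i + 1) \<subseteq> Dsub n i" "subgroup (Usub n (i + 1)) (Cb n)"
    unfolding Usub_def using D
    by (auto intro!: C.generate_is_subgroup dest: subgroup.subset C.generate_subgroup_incl)
  then show "subgroup (Usub n (i + 1)) ((Cb n)\<lparr>carrier := Dsub n i\<rparr>)"
    using C.subgroup_incl D by blast
qed

end
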